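(* Let $\Lambda$ be a countable finitely aligned higher-rank graph and $\mathcal G_\Lambda$ its boundary path groupoid, with unit space $\mathcal G_\Lambda^0=\partial\Lambda$. Then the orbit space $\mathcal G_\Lambda^0/\mathcal G_\Lambda$ is $T_1$ if and only if for each $x\in\partial\Lambda$ and each $v\in\Lambda^0$ the set $Z(v)\cap \mathcal O_x$ is finite.
   Context: For $k\ge 1$, a $k$-graph (higher-rank graph) is a small category $\Lambda$ with a degree functor $d:\Lambda\to\mathbb N^k$ satisfying the factorization property: if $d(\lambda)=m+n$ there are unique $\mu,\nu\in\Lambda$ with $\lambda=\mu\nu$, $d(\mu)=m$, $d(\nu)=n$. Elements are called paths, $r,s$ are range and source, $\Lambda^0=d^{-1}(0)$ is identified with the objects; $v\Lambda=\{\lambda: r(\lambda)=v\}$; for $0\le p\le q\le d(\lambda)$, $\lambda(p,q)$ is the unique path with $\lambda=\lambda'\lambda(p,q)\lambda''$, $d(\lambda')=p$, $d(\lambda(p,q))=q-p$. $\Lambda$ is countable if it has countably many paths. Put $\Lambda^{\min}(\lambda,\mu)=\{(\rho,\tau)\in\Lambda\times\Lambda:\lambda\rho=\mu\tau,\ d(\lambda\rho)=d(\lambda)\vee d(\mu)\}$ (coordinatewise maximum). $\Lambda$ is finitely aligned if $\Lambda^{\min}(\lambda,\mu)$ is finite for all $\lambda,\mu$. A subset $E\subseteq v\Lambda$ is exhaustive if for every $\mu\in v\Lambda$ there is $\lambda\in E$ with $\Lambda^{\min}(\lambda,\mu)\ne\emptyset$. For $m\in(\mathbb N\cup\{\infty\})^k$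 let $\Omega_{k,m}$ be the $k$-graph $\{(p,q)\in\mathbb N^k\times\mathbb N^k: p\le q\le m\}$ with $r(p,q)=(p,p)$, $s(p,q)=(q,q)$, $(p,q)(q,t)=(p,t)$, $d(p,q)=q-p$; write $p$ for $(p,p)$. A boundary path is a degree-preserving functor $x:\Omega_{k,m}\to\Lambda$, with $d(x):=m$, such that for all $n\in\mathbb N^k$ with $n\le m$ and every finite exhaustive $E\subseteq x(n)\Lambda$ there is $\lambda\in E$ with $n+d(\lambda)\le m$ and $x(n,n+d(\lambda))=\lambda$. $\partial\Lambda$ is the set of boundary paths; $r(x)=x(0)$. For $p\in\mathbb N^k$ with $p\le d(x)$, the shift $\sigma^p(x)$ has degree $d(x)-p$ and $\sigma^p(x)(a,b)=x(a+p,b+p)$. For $\mu\in\Lambda$ and $x \in \partial\Lambda$ with $r(x)=s(\mu)$, $\mu x$ is the unique boundary path of degree $d(\mu)+d(x)$ with $(\mu x)(0,d(\mu))=\mu$ and $\sigma^{d(\mu)}(\mu x)=x$. For $\mu\in\Lambda$ and finite $F\subseteq s(\mu)\Lambda$ let $Z(\mu)=\{\mu x\in\partial\Lambda\}=\{y\in\partial\Lambda: d(y)\geq d(\mu),\ y(0,d(\mu))=\mu\}$ and $Z(\mu\setminus F)=Z(\mu)\setminus\bigcup_{\nu\in F}Z(\mu\nu)$. The sets $Z(\mu\setminus F)$ form a base for the topology of $\partial\Lambda$. The boundary path groupoid is $\mathcal G_\Lambda=\{(x,p-q,y): x,y\in\partial\Lambda,\ p,q\in\mathbb N^k,\ p\le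 d(x),\ q\le d(y),\ \sigma^p(x)=\sigma^q(y)\}$ with range $x$, source $y$, product $(x,m,y)(y,n,z)=(x,m+n,z)$, inverse $(x,m,y)^{-1}=(y,-m,x)$; a base for its topology consists of the sets $Z(\lambda *_s\mu)\setminus\bigcup_{\nu\in F}Z(\lambda\nu *_s\mu\nu)$ with $s(\lambda)=s(\mu)$, $F\subseteq s(\lambda)\Lambda$ finite, where $Z(\lambda *_s\mu)=\{(\lambda z,d(\lambda)-d(\mu),\mu z): z\in\partial\Lambda,\ r(z)=s(\lambda)\}$. Its unit space is identified with $\partial\Lambda$. The orbit $\mathcal O_x$ of $x$ is the set of $y\in\partial\Lambda$ for which there are $p\le d(x)$, $q\le d(y)$ in $\mathbb N^k$ with $\sigma^p(x)=\sigma^q(y)$. The orbit space $\mathcal G_\Lambda^0/\mathcal G_\Lambda$ is the set of orbits with the quotient topology from $\partial\Lambda$. *)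

theory Defs
  imports "HOL-Analysis.Analysis" "HOL-Library.Function_Algebras" "HOL-Library.Extended_Nat"
begin

section \<open>Higher-rank graphs\<close>

text \<open>A small category is presented by its set of morphisms alone, each object being identified with
  its identity morphism; \<open>rg\<close> and \<open>sr\<close> are range and source, and \<open>cmp \<Lambda> a b\<close>
  is the composite \<open>ab\<close>, meaningful when \<open>sr \<Lambda> a = rg \<Lambda> b\<close>.\<close>

record 'a category =
  paths :: "'a set"
  rg :: "'a \<Rightarrow> 'a"
  sr :: "'a \<Rightarrow> 'a"
  cmp :: "'a \<Rightarrow> 'a \<Rightarrow> 'a"

text \<open>Degrees in \<open>\<nat>\<^sup>k\<close> are functions on a finite index type \<open>'k\<close>, with pointwise
  addition, order, supremum and subtraction.\<close>

record ('a, 'k) kgraph = "'a category" +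
  deg :: "'a \<Rightarrow> 'k \<Rightarrow> nat"

locale small_category =
  fixes C :: "('a, 'b) category_scheme" (structure)
  assumes rg_closed: "a \<in> paths C \<Longrightarrow> rg C a \<in> paths C"
    and sr_closed: "a \<in> paths C \<Longrightarrow> sr C a \<in> paths C"
    and rg_rg: "a \<in> paths C \<Longrightarrow> rg C (rg C a) = rg C a"
    and sr_rg: "a \<in> paths C \<Longrightarrow> sr C (rg C a) = rg C a"
    and rg_sr: "a \<in> paths C \<Longrightarrow> rg C (sr C a) = sr C a"
    and sr_sr: "a \<in> paths C \<Longrightarrow> sr C (sr C a) = sr C a"
    and cmp_closed: "\<lbrakk>a \<in> paths C; b \<in> paths C; sr C a = rg C b\<rbrakk> \<Longrightarrow> cmp C a b \<in> paths C"
    and rg_cmp: "\<lbrakk>a \<in> paths C; b \<in> paths C; sr C a = rg C b\<rbrakk> \<Longrightarrow> rg C (cmp C a b) = rg C a"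
    and sr_cmp: "\<lbrakk>a \<in> paths C; b \<in> paths C; sr C a = rg C b\<rbrakk> \<Longrightarrow> sr C (cmp C a b) = sr C b"
    and cmp_assoc: "\<lbrakk>a \<in> paths C; b \<in> paths C; c \<in> paths C; sr C a = rg C b; sr C b = rg C c\<rbrakk>
      \<Longrightarrow> cmp C (cmp C a b) c = cmp C a (cmp C b c)"
    and cmp_rg: "a \<in> paths C \<Longrightarrow> cmp C (rg C a) a = a"
    and cmp_sr: "a \<in> paths C \<Longrightarrow> cmp C a (sr C a) = a"

locale higher_rank_graph = small_category \<Lambda>
  for \<Lambda> :: "('a, 'k::finite) kgraph" (structure) +
  assumes deg_cmp: "\<lbrakk>a \<in> paths \<Lambda>; b \<in> paths \<Lambda>; sr \<Lambda> a = rg \<Lambda> b\<rbrakk>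
      \<Longrightarrow> deg \<Lambda> (cmp \<Lambda> a b) = deg \<Lambda> a + deg \<Lambda> b"
    and deg_rg: "a \<in> paths \<Lambda> \<Longrightarrow> deg \<Lambda> (rg \<Lambda> a) = 0"
    and factorization: "\<lbrakk>c \<in> paths \<Lambda>; deg \<Lambda> c = m + n\<rbrakk>
      \<Longrightarrow> \<exists>!(a, b). a \<in> paths \<Lambda> \<and> b \<in> paths \<Lambda> \<and> sr \<Lambda> a = rg \<Lambda> b \<and>
            c = cmp \<Lambda> a b \<and> deg \<Lambda> a = m \<and> deg \<Lambda> b = n"

definition vertices :: "('a, 'k) kgraph \<Rightarrow> 'a set" where
  "vertices \<Lambda> = {v \<in> paths \<Lambda>. deg \<Lambda> v = 0}"

definition paths_at :: "('a, 'k) kgraph \<Rightarrow> 'a \<Rightarrow> 'a set" where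
  "paths_at \<Lambda> v = {a \<in> paths \<Lambda>. rg \<Lambda> a = v}"

lemma (in higher_rank_graph) vertices_eq_objects: "vertices \<Lambda> = rg \<Lambda> ` paths \<Lambda>"
proof
  show "rg \<Lambda> ` paths \<Lambda> \<subseteq> vertices \<Lambda>"
    by (auto simp: vertices_def rg_closed deg_rg)
  show "vertices \<Lambda> \<subseteq> rg \<Lambda> ` paths \<Lambda>"
  proof
    fix v assume "v \<in> vertices \<Lambda>"
    then have v: "v \<in> paths \<Lambda>" "deg \<Lambda> v = 0" by (auto simp: vertices_def)
    have ds: "deg \<Lambda> (sr \<Lambda> v) = 0" using deg_rg[OF sr_closed[OF v(1)]] v(1) by (simp add: rg_sr)
    have "\<exists>!(a, b). a \<in> paths \<Lambda> \<and> b \<in> paths \<Lambda> \<and> sr \<Lambda> a = rg \<Lambda> b \<and>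
            v = cmp \<Lambda> a b \<and> deg \<Lambda> a = 0 \<and> deg \<Lambda> b = 0" (is "\<exists>!p. ?P p")
      using factorization[of v 0 0] v by simp
    moreover have "?P (rg \<Lambda> v, v)" "?P (v, sr \<Lambda> v)"
      using v ds by (auto simp: rg_closed sr_closed sr_rg rg_sr cmp_rg cmp_sr deg_rg)
    ultimately have "(rg \<Lambda> v, v) = (v, sr \<Lambda> v)" by blast
    then show "v \<in> rg \<Lambda> ` paths \<Lambda>" using v(1) by (metis Pair_inject image_eqI)
  qed
qed

definition min_ext :: "('a, 'k) kgraph \<Rightarrow> 'a \<Rightarrow> 'a \<Rightarrow> ('a \<times> 'a) set" where
  "min_ext \<Lambda> a b = {(c, e). c \<in> paths \<Lambda> \<and> e \<in> paths \<Lambda> \<and> sr \<Lambda> a = rg \<Lambda> c \<and> sr \<Lambda> b = rg \<Lambda> e \<and>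
     cmp \<Lambda> a c = cmp \<Lambda> b e \<and> deg \<Lambda> (cmp \<Lambda> a c) = sup (deg \<Lambda> a) (deg \<Lambda> b)}"

definition finitely_aligned :: "('a, 'k) kgraph \<Rightarrow> bool" where
  "finitely_aligned \<Lambda> \<longleftrightarrow> (\<forall>a\<in>paths \<Lambda>. \<forall>b\<in>paths \<Lambda>. finite (min_ext \<Lambda> a b))"

definition exhaustive :: "('a, 'k) kgraph \<Rightarrow> 'a \<Rightarrow> 'a set \<Rightarrow> bool" where
  "exhaustive \<Lambda> v E \<longleftrightarrow> E \<subseteq> paths_at \<Lambda> v \<and> (\<forall>b\<in>paths_at \<Lambda> v. \<exists>a\<in>E. min_ext \<Lambda> a b \<noteq> {})"


section \<open>Boundary paths\<close>

definition ext :: "('k \<Rightarrow> nat) \<Rightarrow> 'k \<Rightarrow> enat" where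
  "ext n = (\<lambda>i. enat (n i))"

definition Omega :: "('k \<Rightarrow> enat) \<Rightarrow> (('k \<Rightarrow> nat) \<times> ('k \<Rightarrow> nat), 'k) kgraph" where
  "Omega m = \<lparr>paths = {(p, q). p \<le> q \<and> ext q \<le> m},
              rg = (\<lambda>(p, q). (p, p)),
              sr = (\<lambda>(p, q). (q, q)),
              cmp = (\<lambda>(p, q) (q', t). (p, t)),
              deg = (\<lambda>(p, q). q - p)\<rparr>"

lemma enat_le_trans: "a \<le> b \<Longrightarrow> enat b \<le> c \<Longrightarrow> enat a \<le> c"
  by (cases c) auto

lemma higher_rank_graph_Omega: "higher_rank_graph (Omega (m :: 'k::finite \<Rightarrow> enat))"
proof (unfold_locales, goal_cases)
  case (15 c j n)
  obtain p q where c: "c = (p, q)" by force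
  have pq: "p \<le> q" "ext q \<le> m" "q - p = j + n" using 15 by (auto simp: c Omega_def)
  have q: "q = p + j + n"
  proof
    fix i
    have "q i - p i = j i + n i" "p i \<le> q i"
      using pq(1) fun_cong[OF pq(3), of i] by (simp_all add: le_fun_def fun_diff_def)
    then show "q i = (p + j + n) i" by simp
  qed
  have m: "ext (p + j) \<le> m"
    unfolding le_fun_def
  proof
    fix i
    have "ext (p + j) i \<le> ext q i" by (simp add: q ext_def)
    also have "\<dots> \<le> m i" using pq(2) by (simp add: le_fun_def)
    finally show "ext (p + j) i \<le> m i" .
  qed
  show ?case
  proof (rule ex1I[of _ "((p, p + j), (p + j, q))"], goal_cases)
    case 1
    have "p \<le> p + j" "p + j \<le> q" "p + j - p = j" "q - (p + j) = n" by (auto simp: q le_fun_def fun_diff_def)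
    then show ?case using m pq(2) by (simp add: Omega_def c)
  next
    case (2 y)
    then obtain a b a' b' where y: "y = ((a, b), (a', b'))" by (metis surj_pair)
    have a: "a = p" "b' = q" "b = a'" "a \<le> b" "b - a = j" using 2 by (auto simp: y Omega_def c)
    have "b = p + j"
    proof
      fix i
      have "p i \<le> b i" "b i - p i = j i"
        using a(1,4) fun_cong[OF a(5), of i] by (simp_all add: le_fun_def fun_diff_def)
      then show "b i = (p + j) i" by simp
    qed
    then show ?case using a by (simp add: y)
  qed
qed (auto simp: Omega_def le_fun_def fun_eq_iff ext_def fun_diff_def intro: enat_le_trans le_trans)

text \<open>A path in \<open>\<Lambda>\<close> of finite or infinite degree is a pair of its degree \<open>m\<close> and a
  degree-preserving functor \<open>\<Omega>\<^sub>k\<^sub>,\<^sub>m \<rightarrow> \<Lambda>\<close>, taken to be \<open>undefined\<close> outside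
  \<open>\<Omega>\<^sub>k\<^sub>,\<^sub>m\<close> so that equality of pairs is equality of functors.\<close>

type_synonym ('a, 'k) bpath = "('k \<Rightarrow> enat) \<times> (('k \<Rightarrow> nat) \<times> ('k \<Rightarrow> nat) \<Rightarrow> 'a)"

definition degree_functors :: "('b, 'k) kgraph \<Rightarrow> ('a, 'k) kgraph \<Rightarrow> ('b \<Rightarrow> 'a) set" where
  "degree_functors C D = {f \<in> paths C \<rightarrow>\<^sub>E paths D.
     (\<forall>a\<in>paths C. f (rg C a) = rg D (f a) \<and> f (sr C a) = sr D (f a) \<and> deg D (f a) = deg C a) \<and>
     (\<forall>a\<in>paths C. \<forall>b\<in>paths C. sr C a = rg C b \<longrightarrow> f (cmp C a b) = cmp D (f a) (f b))}"

lemma degree_functors_apply: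
  assumes "f \<in> degree_functors C D" "a \<in> paths C"
  shows "f a \<in> paths D" "deg D (f a) = deg C a"
  using assms unfolding degree_functors_def by blast+

abbreviation bdeg :: "('a, 'k) bpath \<Rightarrow> 'k \<Rightarrow> enat" where
  "bdeg x \<equiv> fst x"

abbreviation seg :: "('a, 'k) bpath \<Rightarrow> ('k \<Rightarrow> nat) \<Rightarrow> ('k \<Rightarrow> nat) \<Rightarrow> 'a" where
  "seg x p q \<equiv> snd x (p, q)"

definition boundary_paths :: "('a, 'k) kgraph \<Rightarrow> ('a, 'k) bpath set" where
  "boundary_paths \<Lambda> = {x. snd x \<in> degree_functors (Omega (bdeg x)) \<Lambda> \<and>
     (\<forall>n E. ext n \<le> bdeg x \<and> finite E \<and> exhaustive \<Lambda> (seg x n n) E \<longrightarrow>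
        (\<exists>a\<in>E. ext (n + deg \<Lambda> a) \<le> bdeg x \<and> seg x n (n + deg \<Lambda> a) = a))}"

definition shift :: "('k \<Rightarrow> nat) \<Rightarrow> ('a, 'k) bpath \<Rightarrow> ('a, 'k) bpath" where
  "shift p x = (bdeg x - ext p,
     restrict (\<lambda>(a, b). seg x (a + p) (b + p)) (paths (Omega (bdeg x - ext p))))"

definition cylinder :: "('a, 'k) kgraph \<Rightarrow> 'a \<Rightarrow> ('a, 'k) bpath set" where
  "cylinder \<Lambda> a = {y \<in> boundary_paths \<Lambda>. ext (deg \<Lambda> a) \<le> bdeg y \<and> seg y 0 (deg \<Lambda> a) = a}"

definition cylinder_diff :: "('a, 'k) kgraph \<Rightarrow> 'a \<Rightarrow> 'a set \<Rightarrow> ('a, 'k) bpath set" where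
  "cylinder_diff \<Lambda> a F = cylinder \<Lambda> a - (\<Union>b\<in>F. cylinder \<Lambda> (cmp \<Lambda> a b))"

text \<open>The generating sets are a base when \<open>\<Lambda>\<close> is finitely aligned, so generating the topology
  from them as a subbase gives the same open sets.\<close>

definition boundary_topology :: "('a, 'k) kgraph \<Rightarrow> ('a, 'k) bpath topology" where
  "boundary_topology \<Lambda> = topology_generated_by
     {cylinder_diff \<Lambda> a F | a F. a \<in> paths \<Lambda> \<and> finite F \<and> F \<subseteq> paths_at \<Lambda> (sr \<Lambda> a)}"

lemma topspace_boundary_topology [simp]: "topspace (boundary_topology \<Lambda>) = boundary_paths \<Lambda>"
proof
  show "topspace (boundary_topology \<Lambda>) \<subseteq> boundary_paths \<Lambda>"
    by (auto simp: boundary_topology_def cylinder_diff_def cylinder_def)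
  show "boundary_paths \<Lambda> \<subseteq> topspace (boundary_topology \<Lambda>)"
  proof
    fix y assume y: "y \<in> boundary_paths \<Lambda>"
    have "ext 0 \<le> bdeg y" by (simp add: ext_def le_fun_def zero_enat_def[symmetric])
    then have 0: "(0, 0) \<in> paths (Omega (bdeg y))" by (simp add: Omega_def)
    have f: "snd y \<in> degree_functors (Omega (bdeg y)) \<Lambda>" using y by (simp add: boundary_paths_def)
    have v: "seg y 0 0 \<in> paths \<Lambda>" "deg \<Lambda> (seg y 0 0) = 0"
      using degree_functors_apply[OF f 0] by (auto simp: Omega_def)
    have "y \<in> cylinder_diff \<Lambda> (seg y 0 0) {}"
      using y v \<open>ext 0 \<le> bdeg y\<close> by (simp add: cylinder_diff_def cylinder_def)
    then show "y \<in> topspace (boundary_topology \<Lambda>)"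
      unfolding boundary_topology_def topology_generated_by_topspace using v(1) by blast
  qed
qed


section \<open>The boundary path groupoid and its orbit space\<close>

text \<open>An arrow \<open>(x, n, y)\<close> has range \<open>x\<close> and source \<open>y\<close>. The unit
  \<open>(x, 0, x)\<close> is identified with \<open>x\<close>, so the unit space is \<open>boundary_topology \<Lambda>\<close>; the
  topology on the remaining arrows does not enter the orbit space.\<close>

definition boundary_path_groupoid ::
  "('a, 'k) kgraph \<Rightarrow> (('a, 'k) bpath \<times> ('k \<Rightarrow> int) \<times> ('a, 'k) bpath) set" where
  "boundary_path_groupoid \<Lambda> = {(x, (\<lambda>i. int (p i) - int (q i)), y) | x y p q.
     x \<in> boundary_paths \<Lambda> \<and> y \<in> boundary_paths \<Lambda> \<and> ext p \<le> bdeg x \<and> ext q \<le> bdeg y \<and>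
     shift p x = shift q y}"

definition orbit :: "('a, 'k) kgraph \<Rightarrow> ('a, 'k) bpath \<Rightarrow> ('a, 'k) bpath set" where
  "orbit \<Lambda> x = {y \<in> boundary_paths \<Lambda>. \<exists>p q. ext p \<le> bdeg x \<and> ext q \<le> bdeg y \<and> shift p x = shift q y}"

lemma orbit_eq_groupoid:
  "x \<in> boundary_paths \<Lambda> \<Longrightarrow> orbit \<Lambda> x = {y. \<exists>n. (x, n, y) \<in> boundary_path_groupoid \<Lambda>}"
  unfolding orbit_def boundary_path_groupoid_def by blast

definition orbit_space :: "('a, 'k) kgraph \<Rightarrow> ('a, 'k) bpath set topology" where
  "orbit_space \<Lambda> = topology (\<lambda>U. U \<subseteq> orbit \<Lambda> ` boundary_paths \<Lambda> \<and>
     openin (boundary_topology \<Lambda>) {x \<in> boundary_paths \<Lambda>. orbit \<Lambda> x \<in> U})"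

lemma openin_orbit_space:
  "openin (orbit_space \<Lambda>) U \<longleftrightarrow> U \<subseteq> orbit \<Lambda> ` boundary_paths \<Lambda> \<and>
     openin (boundary_topology \<Lambda>) {x \<in> boundary_paths \<Lambda>. orbit \<Lambda> x \<in> U}"
proof -
  let ?pre = "\<lambda>U. {x \<in> boundary_paths \<Lambda>. orbit \<Lambda> x \<in> U}"
  have "istopology (\<lambda>U. U \<subseteq> orbit \<Lambda> ` boundary_paths \<Lambda> \<and> openin (boundary_topology \<Lambda>) (?pre U))"
    unfolding istopology_def
  proof (intro conjI allI impI)
    fix S T
    assume a: "S \<subseteq> orbit \<Lambda> ` boundary_paths \<Lambda> \<and> openin (boundary_topology \<Lambda>) (?pre S)"
      "T \<subseteq> orbit \<Lambda> ` boundary_paths \<Lambda> \<and> openin (boundary_topology \<Lambda>) (?pre T)"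
    have eq: "?pre (S \<inter> T) = ?pre S \<inter> ?pre T" by blast
    show "S \<inter> T \<subseteq> orbit \<Lambda> ` boundary_paths \<Lambda>" using a by blast
    show "openin (boundary_topology \<Lambda>) (?pre (S \<inter> T))"
      unfolding eq using a by (intro openin_Int) blast+
  next
    fix K
    assume a: "\<forall>S\<in>K. S \<subseteq> orbit \<Lambda> ` boundary_paths \<Lambda> \<and> openin (boundary_topology \<Lambda>) (?pre S)"
    have eq: "?pre (\<Union>K) = \<Union> (?pre ` K)" by blast
    show "\<Union>K \<subseteq> orbit \<Lambda> ` boundary_paths \<Lambda>" using a by blast
    show "openin (boundary_topology \<Lambda>) (?pre (\<Union>K))"
      unfolding eq by (rule openin_Union) (use a in blast)
  qed
  then show ?thesis unfolding orbit_space_def by (simp only: topology_inverse')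
qed

lemma quotient_map_orbit: "quotient_map (boundary_topology \<Lambda>) (orbit_space \<Lambda>) (orbit \<Lambda>)"
proof -
  have eq: "{x \<in> boundary_paths \<Lambda>. orbit \<Lambda> x \<in> orbit \<Lambda> ` boundary_paths \<Lambda>} = boundary_paths \<Lambda>"
    by blast
  have "openin (boundary_topology \<Lambda>) (boundary_paths \<Lambda>)"
    using openin_topspace[of "boundary_topology \<Lambda>"] by simp
  then have "openin (orbit_space \<Lambda>) (orbit \<Lambda> ` boundary_paths \<Lambda>)"
    unfolding openin_orbit_space eq by simp
  then have sub: "orbit \<Lambda> ` boundary_paths \<Lambda> \<subseteq> topspace (orbit_space \<Lambda>)"
    by (rule openin_subset)
  have "openin (orbit_space \<Lambda>) (topspace (orbit_space \<Lambda>))" by simp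
  then have "topspace (orbit_space \<Lambda>) \<subseteq> orbit \<Lambda> ` boundary_paths \<Lambda>"
    unfolding openin_orbit_space by (rule conjunct1)
  with sub have top: "topspace (orbit_space \<Lambda>) = orbit \<Lambda> ` boundary_paths \<Lambda>" by (rule subset_antisym[rotated])
  show ?thesis
    unfolding quotient_map_def top topspace_boundary_topology openin_orbit_space by blast
qed

end

theory Submission
  imports Defs
begin

text \<open>A boundary path is determined by the set of its finite initial segments, and the sets that arise
  are cut out of \<open>2\<^sup>\<Lambda>\<close> by conditions that, because of finite alignment, involve
  finitely many coordinates each. Hence every cylinder is compact Hausdorff by Tychonoff's theorem.
  The orbit space is \<open>T\<^sub>1\<close> if and only if all orbits are closed. If an orbit is closed, its
  intersection with \<open>Z(v)\<close> is compact and countable, so by Baire it has an isolated point.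
  Replacing a prefix \<open>\<kappa>\<close> by \<open>\<lambda>\<close> is a continuous injection of
  \<open>Z(\<kappa>)\<close> that preserves orbits, so isolation spreads from one point to the whole orbit, and
  a compact discrete set is finite. Conversely, if an orbit is finite in each of the open sets
  \<open>Z(v)\<close>, which cover the Hausdorff space of boundary paths, then it is closed.\<close>

section \<open>Degrees\<close>

text \<open>A functor on Omega has a domain that varies with its degree, whereas its prefix set is a
  point of one fixed product of two-point spaces. Nonemptiness is in general not a closed condition
  in that product, which is why compactness is proved for single cylinders. The delicate point in
  replacing a prefix k by l is the boundary condition of lz at the vertices (lz)(n) where n does not
  dominate d(l): they need not occur in kz. It is transferred by pulling a finite exhaustive set
  back along a path that ends in the common tail; finite alignment keeps the result finite.
  Countability of the graph enters through the orbits: a member of the orbit of x is determined by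
  the pair (k, l) of exchanged prefixes, so Baire's theorem applies to a compact piece of a closed
  orbit.\<close>

lemma le_add_diff_fun:
  fixes p q :: "'k \<Rightarrow> nat"
  assumes "p \<le> q"
  shows "p + (q - p) = q"
proof
  fix i show "(p + (q - p)) i = q i" using assms by (auto simp: le_fun_def fun_diff_def)
qed

lemma add_diff_fun [simp]: "p + n - p = n" "n + p - p = n"
  for p n :: "'k \<Rightarrow> nat"
  by (auto simp: fun_diff_def fun_eq_iff)

lemma le_add_fun [simp]: "p \<le> p + n" "p \<le> n + p"
  for p n :: "'k \<Rightarrow> nat"
  by (auto simp: le_fun_def)

lemma zero_le_fun [simp]: "0 \<le> n"
  for n :: "'k \<Rightarrow> nat"
  by (auto simp: le_fun_def)

lemma ext_mono: "p \<le> q \<Longrightarrow> ext q \<le> m \<Longrightarrow> ext p \<le> m"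
  unfolding le_fun_def ext_def by (meson enat_le_trans)

lemma ext_zero [simp]: "ext 0 \<le> m"
  by (simp add: ext_def le_fun_def zero_enat_def[symmetric])

lemma ext_sup: "ext p \<le> m \<Longrightarrow> ext q \<le> m \<Longrightarrow> ext (sup p q) \<le> m"
  unfolding le_fun_def ext_def by (auto simp: sup_nat_def max_def)

lemma ext_le_diff_iff:
  assumes "ext p \<le> m"
  shows "ext n \<le> m - ext p \<longleftrightarrow> ext (p + n) \<le> m"
proof -
  have "enat (n i) \<le> m i - enat (p i) \<longleftrightarrow> enat (p i + n i) \<le> m i" for i
    using assms[unfolded le_fun_def ext_def, rule_format, of i] by (cases "m i") auto
  then show ?thesis by (auto simp: le_fun_def ext_def fun_diff_def)
qed

text \<open>Degrees with infinite entries are compared through the finite degrees below them; those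
  supported on one coordinate suffice.\<close>

lemma ext_le_antisym:
  assumes "\<And>n. ext n \<le> m \<longleftrightarrow> ext n \<le> m'"
  shows "m = m'"
proof -
  have *: "m1 i \<le> m2 i" if "\<And>n. ext n \<le> m1 \<Longrightarrow> ext n \<le> m2" for m1 m2 :: "'a \<Rightarrow> enat" and i
  proof (rule ccontr)
    assume "\<not> m1 i \<le> m2 i"
    then obtain k where k: "m2 i = enat k" "enat (Suc k) \<le> m1 i"
      by (cases "m2 i") (auto simp: not_le ileI1 eSuc_enat[symmetric])
    have "ext (\<lambda>j. if j = i then Suc k else 0) \<le> m1"
      using k by (auto simp: ext_def le_fun_def zero_enat_def[symmetric])
    then have "ext (\<lambda>j. if j = i then Suc k else 0) \<le> m2" by (rule that)
    then show False using k by (auto simp: ext_def le_fun_def dest!: spec[of _ i])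
  qed
  show ?thesis using assms by (intro ext antisym) (auto intro!: *)
qed

lemma enat_le_SUP_attained:
  assumes "enat n \<le> (SUP a\<in>A. enat (f a))" "A \<noteq> {}"
  shows "\<exists>a\<in>A. n \<le> f a"
proof (rule ccontr)
  assume *: "\<not> ?thesis"
  \<comment> \<open>Truncated subtraction makes this bound harmless exactly for
    \<open>n = 0\<close>; that case is excluded at the end, since any member of \<open>A\<close> is
    then a witness.\<close>
  then have "f a \<le> n - 1" if "a \<in> A" for a using that by fastforce
  then have "(SUP a\<in>A. enat (f a)) \<le> enat (n - 1)" by (auto intro!: SUP_least)
  then have "enat n \<le> enat (n - 1)" using assms(1) by (rule order_trans[rotated])
  then have "n = 0" by simp
  then show False using * assms(2) by auto
qed

section \<open>Initial segments in a higher-rank graph\<close>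

definition initial :: "('a, 'k) kgraph \<Rightarrow> 'a \<Rightarrow> 'a \<Rightarrow> bool" where
  "initial \<Lambda> a b \<longleftrightarrow> a \<in> paths \<Lambda> \<and> (\<exists>c\<in>paths \<Lambda>. sr \<Lambda> a = rg \<Lambda> c \<and> cmp \<Lambda> a c = b)"

lemma initialI: "a \<in> paths \<Lambda> \<Longrightarrow> c \<in> paths \<Lambda> \<Longrightarrow> sr \<Lambda> a = rg \<Lambda> c \<Longrightarrow> initial \<Lambda> a (cmp \<Lambda> a c)"
  by (auto simp: initial_def)

lemma initialE:
  assumes "initial \<Lambda> a b"
  obtains c where "a \<in> paths \<Lambda>" "c \<in> paths \<Lambda>" "sr \<Lambda> a = rg \<Lambda> c" "b = cmp \<Lambda> a c"
  using assms by (auto simp: initial_def)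

context higher_rank_graph
begin

text \<open>The working form of unique factorization. Degrees add, so equal degrees on the left give
  equal degrees on the right, and \<open>factorization\<close> applies to the common
  composite.\<close>

lemma cmp_inj_deg:
  assumes "a \<in> paths \<Lambda>" "b \<in> paths \<Lambda>" "sr \<Lambda> a = rg \<Lambda> b"
    and "c \<in> paths \<Lambda>" "e \<in> paths \<Lambda>" "sr \<Lambda> c = rg \<Lambda> e"
    and eq: "cmp \<Lambda> a b = cmp \<Lambda> c e" and deg: "deg \<Lambda> a = deg \<Lambda> c"
  shows "a = c" "b = e"
proof -
  let ?f = "cmp \<Lambda> a b"
  have f: "?f \<in> paths \<Lambda>" "deg \<Lambda> ?f = deg \<Lambda> a + deg \<Lambda> b" using assms(1-3) by (simp_all add: cmp_closed deg_cmp)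
  have "deg \<Lambda> ?f = deg \<Lambda> c + deg \<Lambda> e" unfolding eq using assms(4-6) by (simp add: deg_cmp)
  then have be: "deg \<Lambda> b = deg \<Lambda> e" using f(2) deg by (metis add_left_cancel)
  have "\<exists>!(a', b'). a' \<in> paths \<Lambda> \<and> b' \<in> paths \<Lambda> \<and> sr \<Lambda> a' = rg \<Lambda> b' \<and>
            ?f = cmp \<Lambda> a' b' \<and> deg \<Lambda> a' = deg \<Lambda> a \<and> deg \<Lambda> b' = deg \<Lambda> b" (is "\<exists>!p. ?P p")
    using factorization[OF f] .
  moreover have "?P (a, b)" "?P (c, e)" using assms be by auto
  ultimately have "(a, b) = (c, e)" by blast
  then show "a = c" "b = e" by auto
qed

lemma cmp_left_cancel:
  assumes "a \<in> paths \<Lambda>" "b \<in> paths \<Lambda>" "sr \<Lambda> a = rg \<Lambda> b" "c \<in> paths \<Lambda>" "sr \<Lambda> a = rg \<Lambda> c"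
    and "cmp \<Lambda> a b = cmp \<Lambda> a c"
  shows "b = c"
  using cmp_inj_deg(2)[of a b a c] assms by simp

lemma factor_at:
  assumes "c \<in> paths \<Lambda>" "n \<le> deg \<Lambda> c"
  obtains a b where "a \<in> paths \<Lambda>" "b \<in> paths \<Lambda>" "sr \<Lambda> a = rg \<Lambda> b" "c = cmp \<Lambda> a b" "deg \<Lambda> a = n"
proof -
  have "deg \<Lambda> c = n + (deg \<Lambda> c - n)" using le_add_diff_fun[OF assms(2)] by simp
  from factorization[OF assms(1) this] show thesis using that by blast
qed

lemma deg_zero:
  assumes "v \<in> paths \<Lambda>" "deg \<Lambda> v = 0"
  shows "rg \<Lambda> v = v" "sr \<Lambda> v = v"
proof -
  have "v \<in> rg \<Lambda> ` paths \<Lambda>" using vertices_eq_objects assms by (auto simp: vertices_def)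
  then show "rg \<Lambda> v = v" "sr \<Lambda> v = v" by (auto simp: rg_rg sr_rg)
qed

lemma initial_paths: "initial \<Lambda> a b \<Longrightarrow> a \<in> paths \<Lambda>" "initial \<Lambda> a b \<Longrightarrow> b \<in> paths \<Lambda>"
  by (auto simp: initial_def cmp_closed)

lemma initial_refl: "a \<in> paths \<Lambda> \<Longrightarrow> initial \<Lambda> a a"
  unfolding initial_def by (metis cmp_sr rg_sr sr_closed)

lemma initial_rg: "initial \<Lambda> a b \<Longrightarrow> rg \<Lambda> a = rg \<Lambda> b"
  by (auto simp: initial_def rg_cmp)

lemma initial_rg_self: "a \<in> paths \<Lambda> \<Longrightarrow> initial \<Lambda> (rg \<Lambda> a) a"
  unfolding initial_def by (metis cmp_rg rg_closed sr_rg)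

lemma initial_deg: "initial \<Lambda> a b \<Longrightarrow> deg \<Lambda> a \<le> deg \<Lambda> b"
  by (auto simp: initial_def deg_cmp)

lemma initial_trans:
  assumes "initial \<Lambda> a b" "initial \<Lambda> b c"
  shows "initial \<Lambda> a c"
proof -
  from assms(1) obtain d where d: "a \<in> paths \<Lambda>" "d \<in> paths \<Lambda>" "sr \<Lambda> a = rg \<Lambda> d" "b = cmp \<Lambda> a d" by (rule initialE)
  from assms(2) obtain e where e: "b \<in> paths \<Lambda>" "e \<in> paths \<Lambda>" "sr \<Lambda> b = rg \<Lambda> e" "c = cmp \<Lambda> b e" by (rule initialE)
  have "sr \<Lambda> d = rg \<Lambda> e" using d e by (simp add: sr_cmp)
  then have "c = cmp \<Lambda> a (cmp \<Lambda> d e)" "cmp \<Lambda> d e \<in> paths \<Lambda>" "sr \<Lambda> a = rg \<Lambda> (cmp \<Lambda> d e)"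
    using d e by (auto simp: cmp_assoc cmp_closed rg_cmp)
  then show ?thesis using d(1) by (auto simp: initial_def)
qed

text \<open>Cut \<open>b\<close> at the degree of \<open>a\<close>: the left piece and
  \<open>a\<close> are prefixes of \<open>c\<close> of equal degree, hence equal. Below a common
  path, degrees thus decide the prefix order.\<close>

lemma initial_chain:
  assumes "initial \<Lambda> a c" "initial \<Lambda> b c" "deg \<Lambda> a \<le> deg \<Lambda> b"
  shows "initial \<Lambda> a b"
proof -
  from assms(1) obtain d where d: "a \<in> paths \<Lambda>" "d \<in> paths \<Lambda>" "sr \<Lambda> a = rg \<Lambda> d" "c = cmp \<Lambda> a d" by (rule initialE)
  have b: "b \<in> paths \<Lambda>" using assms initial_paths by blast
  from factor_at[OF b assms(3)] obtain a' b' where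
    ab: "a' \<in> paths \<Lambda>" "b' \<in> paths \<Lambda>" "sr \<Lambda> a' = rg \<Lambda> b'" "b = cmp \<Lambda> a' b'" "deg \<Lambda> a' = deg \<Lambda> a" .
  have "initial \<Lambda> a' b" using ab by (auto simp: initial_def)
  then have "initial \<Lambda> a' c" using assms(2) by (rule initial_trans)
  then obtain e where e: "e \<in> paths \<Lambda>" "sr \<Lambda> a' = rg \<Lambda> e" "c = cmp \<Lambda> a' e" by (rule initialE)
  have "a = a'" using cmp_inj_deg(1)[of a d a' e] d e ab by simp
  then show ?thesis using \<open>initial \<Lambda> a' b\<close> by simp
qed

lemma initial_deg_unique:
  assumes "initial \<Lambda> a c" "initial \<Lambda> b c" "deg \<Lambda> a = deg \<Lambda> b"
  shows "a = b"
proof -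
  from assms(1) obtain d where d: "a \<in> paths \<Lambda>" "d \<in> paths \<Lambda>" "sr \<Lambda> a = rg \<Lambda> d" "c = cmp \<Lambda> a d" by (rule initialE)
  from assms(2) obtain e where e: "b \<in> paths \<Lambda>" "e \<in> paths \<Lambda>" "sr \<Lambda> b = rg \<Lambda> e" "c = cmp \<Lambda> b e" by (rule initialE)
  show ?thesis using cmp_inj_deg(1)[of a d b e] d e assms(3) by simp
qed

text \<open>Left cancellation for the prefix order; it lets tails be compared behind either of two
  exchanged prefixes.\<close>

lemma initial_cmp_left_iff:
  assumes a: "a \<in> paths \<Lambda>" and b: "b \<in> paths \<Lambda>" "sr \<Lambda> a = rg \<Lambda> b" and c: "c \<in> paths \<Lambda>" "sr \<Lambda> a = rg \<Lambda> c"
  shows "initial \<Lambda> (cmp \<Lambda> a b) (cmp \<Lambda> a c) \<longleftrightarrow> initial \<Lambda> b c"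
proof
  assume "initial \<Lambda> b c"
  then obtain d where d: "d \<in> paths \<Lambda>" "sr \<Lambda> b = rg \<Lambda> d" "c = cmp \<Lambda> b d" by (rule initialE)
  then show "initial \<Lambda> (cmp \<Lambda> a b) (cmp \<Lambda> a c)"
    unfolding initial_def using a b c by (intro conjI bexI[of _ d]) (auto simp: cmp_closed sr_cmp cmp_assoc)
next
  assume "initial \<Lambda> (cmp \<Lambda> a b) (cmp \<Lambda> a c)"
  then obtain d where d: "d \<in> paths \<Lambda>" "sr \<Lambda> (cmp \<Lambda> a b) = rg \<Lambda> d" "cmp \<Lambda> a c = cmp \<Lambda> (cmp \<Lambda> a b) d"
    by (rule initialE)
  then have s: "sr \<Lambda> b = rg \<Lambda> d" using a b by (simp add: sr_cmp)
  have "c = cmp \<Lambda> b d"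
    by (rule cmp_left_cancel[OF a c]) (use a b d s in \<open>auto simp: cmp_closed rg_cmp cmp_assoc\<close>)
  then show "initial \<Lambda> b c" using b d s by (auto simp: initial_def)
qed

lemma min_ext_initial:
  assumes "(c, e) \<in> min_ext \<Lambda> a b" "a \<in> paths \<Lambda>" "b \<in> paths \<Lambda>"
  shows "initial \<Lambda> a (cmp \<Lambda> a c)" "initial \<Lambda> b (cmp \<Lambda> a c)"
  using assms by (auto simp: min_ext_def initial_def)

text \<open>Factor \<open>f\<close> at the join of the two degrees; the initial piece has both
  \<open>a\<close> and \<open>b\<close> as prefixes. So every common extension lies above a minimal
  one, and arguments about common extensions come within reach of finite alignment.\<close>

lemma min_ext_below:
  assumes "initial \<Lambda> a f" "initial \<Lambda> b f"
  obtains c e where "(c, e) \<in> min_ext \<Lambda> a b" "initial \<Lambda> (cmp \<Lambda> a c) f"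
proof -
  have f: "f \<in> paths \<Lambda>" "deg \<Lambda> a \<le> deg \<Lambda> f" "deg \<Lambda> b \<le> deg \<Lambda> f"
    using assms initial_paths initial_deg by blast+
  then have "sup (deg \<Lambda> a) (deg \<Lambda> b) \<le> deg \<Lambda> f" by simp
  from factor_at[OF f(1) this] obtain g h where g: "g \<in> paths \<Lambda>" "h \<in> paths \<Lambda>" "sr \<Lambda> g = rg \<Lambda> h"
    "f = cmp \<Lambda> g h" "deg \<Lambda> g = sup (deg \<Lambda> a) (deg \<Lambda> b)" .
  have gf: "initial \<Lambda> g f" using g by (auto simp: initial_def)
  have "initial \<Lambda> a g" "initial \<Lambda> b g"
    using initial_chain[OF assms(1) gf] initial_chain[OF assms(2) gf] g(5) by auto
  then obtain c e where "c \<in> paths \<Lambda>" "sr \<Lambda> a = rg \<Lambda> c" "g = cmp \<Lambda> a c"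
    "e \<in> paths \<Lambda>" "sr \<Lambda> b = rg \<Lambda> e" "g = cmp \<Lambda> b e" by (metis initialE)
  then have "(c, e) \<in> min_ext \<Lambda> a b" "initial \<Lambda> (cmp \<Lambda> a c) f" using g(5) gf by (auto simp: min_ext_def)
  then show thesis by (rule that)
qed

end

section \<open>Boundary paths and their sets of initial segments\<close>

text \<open>The last condition encodes the boundary condition at the vertex \<open>x(n)\<close>, with
  \<open>a = x(0, n)\<close>.\<close>

definition boundary_filters :: "('a, 'k) kgraph \<Rightarrow> 'a set set" where
  "boundary_filters \<Lambda> = {X. X \<subseteq> paths \<Lambda> \<and> X \<noteq> {} \<and>
     (\<forall>a b. initial \<Lambda> a b \<longrightarrow> b \<in> X \<longrightarrow> a \<in> X) \<and>
     (\<forall>a\<in>X. \<forall>b\<in>X. \<exists>(c, e)\<in>min_ext \<Lambda> a b. cmp \<Lambda> a c \<in> X) \<and>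
     (\<forall>a\<in>X. \<forall>E. finite E \<and> exhaustive \<Lambda> (sr \<Lambda> a) E \<longrightarrow> (\<exists>e\<in>E. cmp \<Lambda> a e \<in> X))}"

text \<open>The boundary condition is dropped so that shifts can be compared as functors, without
  first proving that they are boundary paths.\<close>

definition gpaths :: "('a, 'k) kgraph \<Rightarrow> ('a, 'k) bpath set" where
  "gpaths \<Lambda> = {x. snd x \<in> degree_functors (Omega (bdeg x)) \<Lambda>}"

definition initials :: "('a, 'k) kgraph \<Rightarrow> ('a, 'k) bpath \<Rightarrow> 'a set" where
  "initials \<Lambda> x = {a \<in> paths \<Lambda>. ext (deg \<Lambda> a) \<le> bdeg x \<and> seg x 0 (deg \<Lambda> a) = a}"

lemma boundary_paths_gpaths: "boundary_paths \<Lambda> \<subseteq> gpaths \<Lambda>"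
  by (auto simp: boundary_paths_def gpaths_def)

lemma in_cylinder_iff:
  "a \<in> paths \<Lambda> \<Longrightarrow> y \<in> cylinder \<Lambda> a \<longleftrightarrow> y \<in> boundary_paths \<Lambda> \<and> a \<in> initials \<Lambda> y"
  by (auto simp: cylinder_def initials_def)

lemma boundary_filtersD:
  assumes "X \<in> boundary_filters \<Lambda>"
  shows "X \<subseteq> paths \<Lambda>" "X \<noteq> {}"
    and "initial \<Lambda> a b \<Longrightarrow> b \<in> X \<Longrightarrow> a \<in> X"
    and "a \<in> X \<Longrightarrow> b \<in> X \<Longrightarrow> \<exists>(c, e)\<in>min_ext \<Lambda> a b. cmp \<Lambda> a c \<in> X"
    and "a \<in> X \<Longrightarrow> finite E \<Longrightarrow> exhaustive \<Lambda> (sr \<Lambda> a) E \<Longrightarrow> \<exists>e\<in>E. cmp \<Lambda> a e \<in> X"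
  using assms unfolding boundary_filters_def by blast+

lemma gpathsD:
  assumes "x \<in> gpaths \<Lambda>" "p \<le> q" "ext q \<le> bdeg x"
  shows "seg x p q \<in> paths \<Lambda>" "deg \<Lambda> (seg x p q) = q - p"
    and "rg \<Lambda> (seg x p q) = seg x p p" "sr \<Lambda> (seg x p q) = seg x q q"
proof -
  have f: "snd x \<in> degree_functors (Omega (bdeg x)) \<Lambda>" using assms(1) by (simp add: gpaths_def)
  have pq: "(p, q) \<in> paths (Omega (bdeg x))" using assms by (simp add: Omega_def)
  have O: "rg (Omega (bdeg x)) (p, q) = (p, p)" "sr (Omega (bdeg x)) (p, q) = (q, q)"
    "deg (Omega (bdeg x)) (p, q) = q - p" by (auto simp: Omega_def)
  have *: "snd x (rg (Omega (bdeg x)) (p, q)) = rg \<Lambda> (snd x (p, q)) \<and>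
    snd x (sr (Omega (bdeg x)) (p, q)) = sr \<Lambda> (snd x (p, q)) \<and>
    deg \<Lambda> (snd x (p, q)) = deg (Omega (bdeg x)) (p, q)"
    using f pq unfolding degree_functors_def by blast
  show "seg x p q \<in> paths \<Lambda>" using degree_functors_apply(1)[OF f pq] .
  show "deg \<Lambda> (seg x p q) = q - p" "rg \<Lambda> (seg x p q) = seg x p p" "sr \<Lambda> (seg x p q) = seg x q q"
    using * by (simp_all add: O)
qed

lemma gpaths_cmp:
  assumes "x \<in> gpaths \<Lambda>" "p \<le> q" "q \<le> t" "ext t \<le> bdeg x"
  shows "cmp \<Lambda> (seg x p q) (seg x q t) = seg x p t"
proof -
  have f: "snd x \<in> degree_functors (Omega (bdeg x)) \<Lambda>" using assms(1) by (simp add: gpaths_def)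
  have pq: "(p, q) \<in> paths (Omega (bdeg x))" "(q, t) \<in> paths (Omega (bdeg x))"
    "sr (Omega (bdeg x)) (p, q) = rg (Omega (bdeg x)) (q, t)"
    "cmp (Omega (bdeg x)) (p, q) (q, t) = (p, t)"
    using assms ext_mono[of q t] by (auto simp: Omega_def)
  have "snd x (cmp (Omega (bdeg x)) (p, q) (q, t)) = cmp \<Lambda> (snd x (p, q)) (snd x (q, t))"
    using f pq(1-3) unfolding degree_functors_def by blast
  then show ?thesis by (simp add: pq(4))
qed

lemma gpathsI:
  assumes "\<And>p q. p \<le> q \<Longrightarrow> ext q \<le> m \<Longrightarrow> f (p, q) \<in> paths \<Lambda> \<and> deg \<Lambda> (f (p, q)) = q - p \<and>
      rg \<Lambda> (f (p, q)) = f (p, p) \<and> sr \<Lambda> (f (p, q)) = f (q, q)"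
    and "\<And>p q t. p \<le> q \<Longrightarrow> q \<le> t \<Longrightarrow> ext t \<le> m \<Longrightarrow> f (p, t) = cmp \<Lambda> (f (p, q)) (f (q, t))"
    and "\<And>p q. \<not> (p \<le> q \<and> ext q \<le> m) \<Longrightarrow> f (p, q) = undefined"
  shows "(m, f) \<in> gpaths \<Lambda>"
proof -
  have P: "paths (Omega m) = {(p, q). p \<le> q \<and> ext q \<le> m}" by (simp add: Omega_def)
  have "f \<in> paths (Omega m) \<rightarrow>\<^sub>E paths \<Lambda>"
    by (rule PiE_I) (use assms(1,3) P in auto)
  moreover have "f (rg (Omega m) a) = rg \<Lambda> (f a) \<and> f (sr (Omega m) a) = sr \<Lambda> (f a) \<and>
      deg \<Lambda> (f a) = deg (Omega m) a" if "a \<in> paths (Omega m)" for a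
    using that assms(1)[of "fst a" "snd a"] unfolding P by (cases a) (simp add: Omega_def)
  moreover have "f (cmp (Omega m) a b) = cmp \<Lambda> (f a) (f b)"
    if "a \<in> paths (Omega m)" "b \<in> paths (Omega m)" "sr (Omega m) a = rg (Omega m) b" for a b
    using that assms(2)[of "fst a" "snd a" "snd b"] unfolding P
    by (cases a, cases b) (simp add: Omega_def)
  ultimately show ?thesis by (simp add: gpaths_def degree_functors_def)
qed

lemma gpaths_undefined:
  "x \<in> gpaths \<Lambda> \<Longrightarrow> \<not> (p \<le> q \<and> ext q \<le> bdeg x) \<Longrightarrow> seg x p q = undefined"
  unfolding gpaths_def degree_functors_def
  by (auto dest!: PiE_arb[where x = "(p, q)"] simp: Omega_def)

lemma seg_in_initials:
  assumes "x \<in> gpaths \<Lambda>" "ext n \<le> bdeg x"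
  shows "seg x 0 n \<in> initials \<Lambda> x"
  using gpathsD[OF assms(1) zero_le_fun assms(2)] assms(2) by (simp add: initials_def)

section \<open>The prefix set of a path\<close>

context higher_rank_graph
begin

lemma ext_le_bdeg_iff:
  assumes "x \<in> gpaths \<Lambda>"
  shows "ext n \<le> bdeg x \<longleftrightarrow> (\<exists>a\<in>initials \<Lambda> x. deg \<Lambda> a = n)"
  using seg_in_initials[OF assms, of n] gpathsD(2)[OF assms zero_le_fun, of n]
  by (auto simp: initials_def)

text \<open>The degree is read off from the degrees of the prefixes, and x(p,q) is the only path
  that completes x(0,p) to x(0,q). Outside the common domain both functors are
  \<open>undefined\<close>.\<close>

lemma initials_inj:
  assumes x: "x \<in> gpaths \<Lambda>" and y: "y \<in> gpaths \<Lambda>" and eq: "initials \<Lambda> x = initials \<Lambda> y"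
  shows "x = y"
proof -
  have d: "bdeg x = bdeg y"
    by (rule ext_le_antisym) (simp add: ext_le_bdeg_iff[OF x] ext_le_bdeg_iff[OF y] eq)
  have 0: "seg x 0 n = seg y 0 n" if "ext n \<le> bdeg x" for n
    using seg_in_initials[OF x that] gpathsD(2)[OF x zero_le_fun that] unfolding eq
    by (simp add: initials_def)
  have "seg x p q = seg y p q" for p q
  proof (cases "p \<le> q \<and> ext q \<le> bdeg x")
    case True
    then have p: "ext p \<le> bdeg x" using ext_mono by blast
    note X = gpathsD[OF x] gpaths_cmp[OF x] and Y = gpathsD[OF y] gpaths_cmp[OF y]
    show ?thesis
    proof (rule cmp_left_cancel[of "seg x 0 p"])
      show "cmp \<Lambda> (seg x 0 p) (seg x p q) = cmp \<Lambda> (seg x 0 p) (seg y p q)"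
        using X(5)[of 0 p q] Y(5)[of 0 p q] True 0[of p] 0[of q] p d by simp
    next
      show "sr \<Lambda> (seg x 0 p) = rg \<Lambda> (seg y p q)"
        using 0[OF p] Y(4)[of 0 p] Y(3)[of p q] True p d by simp
    qed (use X Y True p d in auto)
  next
    case False
    then show ?thesis using gpaths_undefined[OF x] gpaths_undefined[OF y] d by auto
  qed
  then show ?thesis using d by (auto simp: prod_eq_iff fun_eq_iff)
qed

lemma initials_boundary_filter:
  assumes x: "x \<in> boundary_paths \<Lambda>"
  shows "initials \<Lambda> x \<in> boundary_filters \<Lambda>"
proof -
  have g: "x \<in> gpaths \<Lambda>" using x boundary_paths_gpaths by blast
  note X = gpathsD[OF g] and C = gpaths_cmp[OF g]
  have mem: "ext (deg \<Lambda> a) \<le> bdeg x" "seg x 0 (deg \<Lambda> a) = a" if "a \<in> initials \<Lambda> x" for a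
    using that by (auto simp: initials_def)
  have hered: "a \<in> initials \<Lambda> x" if ab: "initial \<Lambda> a b" and b: "b \<in> initials \<Lambda> x" for a b
  proof -
    from ab obtain c where c: "a \<in> paths \<Lambda>" "c \<in> paths \<Lambda>" "sr \<Lambda> a = rg \<Lambda> c" "b = cmp \<Lambda> a c" by (rule initialE)
    have le: "deg \<Lambda> a \<le> deg \<Lambda> b" using ab by (rule initial_deg)
    have e: "ext (deg \<Lambda> a) \<le> bdeg x" using ext_mono[OF le] mem[OF b] by blast
    \<comment> \<open>The segment of \<open>x\<close> of this degree is also a prefix of
      \<open>b\<close>, and prefixes of one path are determined by their degrees.\<close>
    have "seg x 0 (deg \<Lambda> a) = a"
    proof (rule initial_deg_unique[OF _ ab])
      have "cmp \<Lambda> (seg x 0 (deg \<Lambda> a)) (seg x (deg \<Lambda> a) (deg \<Lambda> b)) = b"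
        using C[of 0 "deg \<Lambda> a" "deg \<Lambda> b"] le mem[OF b] by simp
      then show "initial \<Lambda> (seg x 0 (deg \<Lambda> a)) b"
        unfolding initial_def using X(1,3,4)[of "deg \<Lambda> a" "deg \<Lambda> b"] X(1,4)[of 0 "deg \<Lambda> a"] le e mem(1)[OF b]
        by (intro conjI bexI[of _ "seg x (deg \<Lambda> a) (deg \<Lambda> b)"]) auto
      show "deg \<Lambda> (seg x 0 (deg \<Lambda> a)) = deg \<Lambda> a" using X(2)[OF _ e] by simp
    qed
    then show ?thesis using c e by (simp add: initials_def)
  qed
  have direct: "\<exists>(c, e)\<in>min_ext \<Lambda> a b. cmp \<Lambda> a c \<in> initials \<Lambda> x"
    if a: "a \<in> initials \<Lambda> x" and b: "b \<in> initials \<Lambda> x" for a b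
  proof -
    let ?s = "sup (deg \<Lambda> a) (deg \<Lambda> b)"
    have s: "ext ?s \<le> bdeg x" by (rule ext_sup[OF mem(1)[OF a] mem(1)[OF b]])
    \<comment> \<open>Both members are prefixes of the segment up to the join of their degrees,
      which therefore lies above a minimal common extension.\<close>
    have i: "initial \<Lambda> d (seg x 0 ?s)" if d: "d \<in> initials \<Lambda> x" and "deg \<Lambda> d \<le> ?s" for d
      unfolding initial_def using C[of 0 "deg \<Lambda> d" ?s] X(1,3)[of "deg \<Lambda> d" ?s] X(1,4)[of 0 "deg \<Lambda> d"]
        mem[OF d] that(2) s by (intro conjI bexI[of _ "seg x (deg \<Lambda> d) ?s"]) auto
    from min_ext_below[OF i[OF a] i[OF b]] obtain c e where
      "(c, e) \<in> min_ext \<Lambda> a b" "initial \<Lambda> (cmp \<Lambda> a c) (seg x 0 ?s)" by auto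
    moreover have "cmp \<Lambda> a c \<in> initials \<Lambda> x" using hered calculation(2) seg_in_initials[OF g s] by blast
    ultimately show ?thesis by blast
  qed
  have bd: "\<exists>e\<in>E. cmp \<Lambda> a e \<in> initials \<Lambda> x"
    if a: "a \<in> initials \<Lambda> x" and E: "finite E" "exhaustive \<Lambda> (sr \<Lambda> a) E" for a E
  proof -
    let ?n = "deg \<Lambda> a"
    have s: "sr \<Lambda> a = seg x ?n ?n" using X(4)[of 0 ?n] mem[OF a] by simp
    obtain e where e: "e \<in> E" "ext (?n + deg \<Lambda> e) \<le> bdeg x" "seg x ?n (?n + deg \<Lambda> e) = e"
      using x mem(1)[OF a] E unfolding boundary_paths_def s by blast
    have "cmp \<Lambda> a e = seg x 0 (?n + deg \<Lambda> e)" using C[of 0 ?n "?n + deg \<Lambda> e"] e mem[OF a] by simp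
    then have "cmp \<Lambda> a e \<in> initials \<Lambda> x" using seg_in_initials[OF g e(2)] by simp
    then show ?thesis using e(1) by blast
  qed
  have "seg x 0 0 \<in> initials \<Lambda> x" by (rule seg_in_initials[OF g]) simp
  then show ?thesis
    unfolding boundary_filters_def using hered direct bd by (auto simp: initials_def)
qed

section \<open>From a filter of prefixes back to a boundary path\<close>

lemma boundary_filter_deg_ge:
  assumes X: "X \<in> boundary_filters \<Lambda>" and le: "\<And>i. enat (n i) \<le> (SUP a\<in>X. enat (deg \<Lambda> a i))"
  obtains a where "a \<in> X" "n \<le> deg \<Lambda> a"
proof -
  \<comment> \<open>Each coordinate of \<open>n\<close> is reached by some member. Directedness
    merges these members one coordinate at a time, as a minimal common extension has the join of the
    degrees; the index type being finite, \<open>I\<close> can grow to \<open>UNIV\<close>.\<close>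
  have "\<exists>a\<in>X. \<forall>i\<in>I. n i \<le> deg \<Lambda> a i" for I
  proof (induction I rule: finite_induct[OF finite])
    case 1
    show ?case using boundary_filtersD(2)[OF X] by auto
  next
    case (2 i I)
    then obtain a where a: "a \<in> X" "\<forall>i\<in>I. n i \<le> deg \<Lambda> a i" by blast
    obtain b where b: "b \<in> X" "n i \<le> deg \<Lambda> b i"
      using enat_le_SUP_attained[OF le boundary_filtersD(2)[OF X]] by blast
    obtain c e where c: "(c, e) \<in> min_ext \<Lambda> a b" "cmp \<Lambda> a c \<in> X"
      using boundary_filtersD(4)[OF X a(1) b(1)] by blast
    have "deg \<Lambda> (cmp \<Lambda> a c) = sup (deg \<Lambda> a) (deg \<Lambda> b)" using c(1) by (auto simp: min_ext_def)
    then have "\<forall>i\<in>insert i I. n i \<le> deg \<Lambda> (cmp \<Lambda> a c) i"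
      using a(2) b(2) by (auto simp: le_supI1 le_supI2)
    then show ?case using c(2) by blast
  qed
  from this[of UNIV] show thesis using that by (auto simp: le_fun_def)
qed

lemma boundary_filter_deg_unique:
  assumes X: "X \<in> boundary_filters \<Lambda>" and ab: "a \<in> X" "b \<in> X" "deg \<Lambda> a = deg \<Lambda> b"
  shows "a = b"
proof -
  obtain c e where c: "(c, e) \<in> min_ext \<Lambda> a b" "cmp \<Lambda> a c \<in> X"
    using boundary_filtersD(4)[OF X ab(1,2)] by blast
  have "a \<in> paths \<Lambda>" "b \<in> paths \<Lambda>" using boundary_filtersD(1)[OF X] ab by auto
  then show ?thesis using initial_deg_unique[OF min_ext_initial[OF c(1)]] ab(3) by blast
qed

lemma boundary_filter_initial:
  assumes X: "X \<in> boundary_filters \<Lambda>" and ab: "a \<in> X" "b \<in> X" "deg \<Lambda> a \<le> deg \<Lambda> b"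
  shows "initial \<Lambda> a b"
proof -
  obtain c e where c: "(c, e) \<in> min_ext \<Lambda> a b" "cmp \<Lambda> a c \<in> X"
    using boundary_filtersD(4)[OF X ab(1,2)] by blast
  have "a \<in> paths \<Lambda>" "b \<in> paths \<Lambda>" using boundary_filtersD(1)[OF X] ab by auto
  then show ?thesis using initial_chain[OF min_ext_initial[OF c(1)]] ab(3) by blast
qed

text \<open>The members of \<open>X\<close>, indexed by degree, form a compatible system
  \<open>L\<close>. The functor sends (p,q) to the path that completes \<open>L p\<close> to
  \<open>L q\<close>, and its degree is the supremum of the degrees in \<open>X\<close>.\<close>

lemma boundary_filter_initials:
  assumes X: "X \<in> boundary_filters \<Lambda>"
  shows "\<exists>x\<in>boundary_paths \<Lambda>. initials \<Lambda> x = X"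
proof -
  note XP = subsetD[OF boundary_filtersD(1)[OF X]]
  define m where "m i = (SUP a\<in>X. enat (deg \<Lambda> a i))" for i
  have deg_m: "ext (deg \<Lambda> a) \<le> m" if "a \<in> X" for a
    using that by (auto simp: ext_def le_fun_def m_def intro: SUP_upper)
  \<comment> \<open>Some member has degree at least \<open>n\<close>, even where the supremum is
    infinite. Its cut at \<open>n\<close> lies in \<open>X\<close> because \<open>X\<close> is
    closed under prefixes.\<close>
  have ex: "\<exists>!a. a \<in> X \<and> deg \<Lambda> a = n" if n: "ext n \<le> m" for n
  proof (rule ex_ex1I)
    have "enat (n i) \<le> (SUP a\<in>X. enat (deg \<Lambda> a i))" for i using n by (simp add: ext_def le_fun_def m_def)
    then obtain b where b: "b \<in> X" "n \<le> deg \<Lambda> b" using boundary_filter_deg_ge[OF X] by blast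
    from factor_at[OF XP[OF b(1)] b(2)] obtain a c where
      "a \<in> paths \<Lambda>" "c \<in> paths \<Lambda>" "sr \<Lambda> a = rg \<Lambda> c" "b = cmp \<Lambda> a c" "deg \<Lambda> a = n" .
    then show "\<exists>a. a \<in> X \<and> deg \<Lambda> a = n" using boundary_filtersD(3)[OF X _ b(1)] by (blast intro: initialI)
  qed (use boundary_filter_deg_unique[OF X] in auto)
  define L where "L n = (THE a. a \<in> X \<and> deg \<Lambda> a = n)" for n
  have L: "L n \<in> X" "deg \<Lambda> (L n) = n" if "ext n \<le> m" for n
    using theI'[OF ex[OF that]] by (auto simp: L_def)
  have L_eq: "L (deg \<Lambda> a) = a" if "a \<in> X" for a
    using boundary_filter_deg_unique[OF X] L[OF deg_m[OF that]] that by blast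
  have fac: "\<exists>!c. c \<in> paths \<Lambda> \<and> sr \<Lambda> (L p) = rg \<Lambda> c \<and> cmp \<Lambda> (L p) c = L q"
    if pq: "p \<le> q" "ext q \<le> m" for p q
  proof (rule ex_ex1I)
    have p: "ext p \<le> m" using ext_mono pq by blast
    have "initial \<Lambda> (L p) (L q)" using boundary_filter_initial[OF X] L[OF p] L[OF pq(2)] pq(1) by simp
    then show "\<exists>c. c \<in> paths \<Lambda> \<and> sr \<Lambda> (L p) = rg \<Lambda> c \<and> cmp \<Lambda> (L p) c = L q"
      by (auto simp: initial_def)
    show "c = c'" if "c \<in> paths \<Lambda> \<and> sr \<Lambda> (L p) = rg \<Lambda> c \<and> cmp \<Lambda> (L p) c = L q"
      "c' \<in> paths \<Lambda> \<and> sr \<Lambda> (L p) = rg \<Lambda> c' \<and> cmp \<Lambda> (L p) c' = L q" for c c'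
      using cmp_left_cancel[of "L p" c c'] XP[OF L(1)[OF p]] that by auto
  qed
  define f where "f = (\<lambda>(p, q). if p \<le> q \<and> ext q \<le> m
      then THE c. c \<in> paths \<Lambda> \<and> sr \<Lambda> (L p) = rg \<Lambda> c \<and> cmp \<Lambda> (L p) c = L q else undefined)"
  have f: "f (p, q) \<in> paths \<Lambda>" "sr \<Lambda> (L p) = rg \<Lambda> (f (p, q))" "cmp \<Lambda> (L p) (f (p, q)) = L q"
    if pq: "p \<le> q" "ext q \<le> m" for p q
    using theI'[OF fac[OF pq]] pq by (auto simp: f_def)
  have f_eq: "f (p, q) = c"
    if "p \<le> q" "ext q \<le> m" "c \<in> paths \<Lambda>" "sr \<Lambda> (L p) = rg \<Lambda> c" "cmp \<Lambda> (L p) c = L q" for p q c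
    using fac[OF that(1,2)] f[OF that(1,2)] that(3-5) by blast
  \<comment> \<open>What completes a path to itself is its source, so the object x(p) is the source
    of \<open>L p\<close>.\<close>
  have f_refl: "f (p, p) = sr \<Lambda> (L p)" if p: "ext p \<le> m" for p
    by (rule f_eq) (use XP[OF L(1)[OF p]] p in \<open>auto simp: sr_closed rg_sr cmp_sr\<close>)
  have g: "(m, f) \<in> gpaths \<Lambda>"
  proof (rule gpathsI)
    fix p q assume pq: "p \<le> q" "ext q \<le> m"
    have p: "ext p \<le> m" using ext_mono pq by blast
    have LP: "L p \<in> paths \<Lambda>" using XP L(1)[OF p] by blast
    have "deg \<Lambda> (L q) = deg \<Lambda> (L p) + deg \<Lambda> (f (p, q))" using deg_cmp[OF LP f(1,2)[OF pq]] f(3)[OF pq] by simp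
    then have "q = p + deg \<Lambda> (f (p, q))" using L(2)[OF p] L(2)[OF pq(2)] by simp
    then have "deg \<Lambda> (f (p, q)) = q - p" by (metis add_diff_fun(1))
    moreover have "sr \<Lambda> (f (p, q)) = f (q, q)" using sr_cmp[OF LP f(1,2)[OF pq]] f(3)[OF pq] f_refl[OF pq(2)] by simp
    ultimately show "f (p, q) \<in> paths \<Lambda> \<and> deg \<Lambda> (f (p, q)) = q - p \<and>
      rg \<Lambda> (f (p, q)) = f (p, p) \<and> sr \<Lambda> (f (p, q)) = f (q, q)"
      using f[OF pq] f_refl[OF p] by simp
  next
    fix p q t assume pqt: "p \<le> q" "q \<le> t" "ext t \<le> m"
    have q: "ext q \<le> m" and p: "ext p \<le> m" using ext_mono pqt order_trans by blast+
    have LP: "L p \<in> paths \<Lambda>" using XP L(1)[OF p] by blast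
    have "sr \<Lambda> (f (p, q)) = rg \<Lambda> (f (q, t))"
      using sr_cmp[OF LP f(1,2)[OF pqt(1) q]] f(3)[OF pqt(1) q] f(2)[OF pqt(2,3)] by simp
    then show "f (p, t) = cmp \<Lambda> (f (p, q)) (f (q, t))"
      using f[OF pqt(1) q] f[OF pqt(2,3)] LP cmp_assoc[OF LP, of "f (p, q)" "f (q, t)"]
      by (intro f_eq) (use pqt in \<open>auto simp: cmp_closed rg_cmp\<close>)
  qed (auto simp: f_def)
  \<comment> \<open>\<open>L 0\<close> has degree zero and is thus the vertex at which
    \<open>L n\<close> starts, so completing it to \<open>L n\<close> takes all of
    \<open>L n\<close>.\<close>
  have f0: "f (0, n) = L n" if n: "ext n \<le> m" for n
  proof (rule f_eq)
    have "L 0 \<in> paths \<Lambda>" "deg \<Lambda> (L 0) = 0" using L[of 0] XP by auto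
    note L0 = this deg_zero[OF this]
    have "initial \<Lambda> (L 0) (L n)" using boundary_filter_initial[OF X] L[of 0] L[OF n] by simp
    then have "L 0 = rg \<Lambda> (L n)" using initial_rg L0 by metis
    then show "sr \<Lambda> (L 0) = rg \<Lambda> (L n)" "cmp \<Lambda> (L 0) (L n) = L n"
      using XP[OF L(1)[OF n]] by (auto simp: sr_rg cmp_rg)
  qed (use n XP[OF L(1)[OF n]] in auto)
  have init: "initials \<Lambda> (m, f) = X"
  proof (intro equalityI subsetI)
    fix a assume "a \<in> initials \<Lambda> (m, f)"
    then have "ext (deg \<Lambda> a) \<le> m" "L (deg \<Lambda> a) = a" using f0 by (auto simp: initials_def)
    then show "a \<in> X" using L(1) by metis
  next
    fix a assume a: "a \<in> X"
    then show "a \<in> initials \<Lambda> (m, f)" using deg_m[OF a] f0 L_eq XP by (auto simp: initials_def)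
  qed
  \<comment> \<open>The boundary condition at corner \<open>n\<close> is the filter condition at
    \<open>L n\<close>, whose source is the vertex \<open>f (n, n)\<close>.\<close>
  have "\<exists>e\<in>E. ext (n + deg \<Lambda> e) \<le> m \<and> f (n, n + deg \<Lambda> e) = e"
    if n: "ext n \<le> m" and E: "finite E" "exhaustive \<Lambda> (f (n, n)) E" for n E
  proof -
    obtain e where e: "e \<in> E" "cmp \<Lambda> (L n) e \<in> X"
      using boundary_filtersD(5)[OF X L(1)[OF n] E(1)] E(2) f_refl[OF n] by auto
    have ep: "e \<in> paths \<Lambda>" "sr \<Lambda> (L n) = rg \<Lambda> e"
      using E(2) e(1) f_refl[OF n] by (auto simp: exhaustive_def paths_at_def)
    have d: "deg \<Lambda> (cmp \<Lambda> (L n) e) = n + deg \<Lambda> e"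
      using deg_cmp[OF XP[OF L(1)[OF n]] ep] L(2)[OF n] by simp
    have m: "ext (n + deg \<Lambda> e) \<le> m" using deg_m[OF e(2)] d by simp
    have "f (n, n + deg \<Lambda> e) = e" using L_eq[OF e(2)] d by (intro f_eq) (use m ep in auto)
    then show ?thesis using e(1) m by blast
  qed
  then have "(m, f) \<in> boundary_paths \<Lambda>" using g by (auto simp: boundary_paths_def gpaths_def)
  then show ?thesis using init by blast
qed

text \<open>The inverse of \<open>initials\<close>: on \<open>boundary_filters\<close> the choice is
  unique by \<open>initials_inj\<close>.\<close>

definition path_of :: "'a set \<Rightarrow> ('a, 'k) bpath" where
  "path_of X = (SOME x. x \<in> boundary_paths \<Lambda> \<and> initials \<Lambda> x = X)"

lemma path_of:
  assumes "X \<in> boundary_filters \<Lambda>"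
  shows "path_of X \<in> boundary_paths \<Lambda>" "initials \<Lambda> (path_of X) = X"
proof -
  have "\<exists>x. x \<in> boundary_paths \<Lambda> \<and> initials \<Lambda> x = X" using boundary_filter_initials[OF assms] by blast
  from someI_ex[OF this] show "path_of X \<in> boundary_paths \<Lambda>" "initials \<Lambda> (path_of X) = X"
    by (auto simp: path_of_def)
qed

lemma path_of_initials:
  assumes "x \<in> boundary_paths \<Lambda>"
  shows "path_of (initials \<Lambda> x) = x"
proof (rule initials_inj)
  note * = path_of[OF initials_boundary_filter[OF assms]]
  show "path_of (initials \<Lambda> x) \<in> gpaths \<Lambda>" "x \<in> gpaths \<Lambda>"
    using *(1) assms boundary_paths_gpaths by (auto dest: subsetD)
  show "initials \<Lambda> (path_of (initials \<Lambda> x)) = initials \<Lambda> x" by (rule *(2))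
qed

end

section \<open>Tail equivalence\<close>

text \<open>For the prefix sets of x and y this says x = lz and y = mz with one tail z. It takes the
  place of an equality of shifts.\<close>

definition tail_eq :: "('a, 'k) kgraph \<Rightarrow> 'a \<Rightarrow> 'a \<Rightarrow> 'a set \<Rightarrow> 'a set \<Rightarrow> bool" where
  "tail_eq \<Lambda> l m X Y \<longleftrightarrow> l \<in> X \<and> m \<in> Y \<and> sr \<Lambda> l = sr \<Lambda> m \<and>
     (\<forall>n\<in>paths \<Lambda>. rg \<Lambda> n = sr \<Lambda> l \<longrightarrow> (cmp \<Lambda> l n \<in> X \<longleftrightarrow> cmp \<Lambda> m n \<in> Y))"

text \<open>If \<open>X\<close> is the set of initial segments of \<open>kz\<close>, this is that of
  \<open>lz\<close>.\<close>

definition transplant :: "('a, 'k) kgraph \<Rightarrow> 'a \<Rightarrow> 'a \<Rightarrow> 'a set \<Rightarrow> 'a set" where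
  "transplant \<Lambda> k l X =
     {a. \<exists>n\<in>paths \<Lambda>. rg \<Lambda> n = sr \<Lambda> k \<and> cmp \<Lambda> k n \<in> X \<and> initial \<Lambda> a (cmp \<Lambda> l n)}"

lemma tail_eq_sym: "tail_eq \<Lambda> l m X Y \<Longrightarrow> tail_eq \<Lambda> m l Y X"
  by (auto simp: tail_eq_def)

lemma tail_eqD:
  assumes "tail_eq \<Lambda> l m X Y"
  shows "l \<in> X" "m \<in> Y" "sr \<Lambda> l = sr \<Lambda> m"
    and "n \<in> paths \<Lambda> \<Longrightarrow> rg \<Lambda> n = sr \<Lambda> l \<Longrightarrow> cmp \<Lambda> l n \<in> X \<longleftrightarrow> cmp \<Lambda> m n \<in> Y"
  using assms unfolding tail_eq_def by blast+

section \<open>Orbits in terms of prefix sets\<close>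

context higher_rank_graph
begin

lemma shift_gpaths:
  assumes x: "x \<in> gpaths \<Lambda>" and p: "ext p \<le> bdeg x"
  shows "shift p x \<in> gpaths \<Lambda>"
  unfolding shift_def
proof (rule gpathsI)
  have le: "ext (b + p) \<le> bdeg x" if "ext b \<le> bdeg x - ext p" for b
    using that ext_le_diff_iff[OF p, of b] by (simp add: add.commute)
  have mono: "a + p \<le> b + p" if "a \<le> b" for a b :: "'k \<Rightarrow> nat" using that by (simp add: le_fun_def)
  have diff: "b + p - (a + p) = b - a" for a b :: "'k \<Rightarrow> nat" by (simp add: fun_eq_iff fun_diff_def)
  let ?f = "restrict (\<lambda>(a, b). seg x (a + p) (b + p)) (paths (Omega (bdeg x - ext p)))"
  have f: "?f (a, b) = seg x (a + p) (b + p)" if "a \<le> b" "ext b \<le> bdeg x - ext p" for a b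
    using that by (simp add: Omega_def)
  show "?f (a, b) \<in> paths \<Lambda> \<and> deg \<Lambda> (?f (a, b)) = b - a \<and> rg \<Lambda> (?f (a, b)) = ?f (a, a) \<and> sr \<Lambda> (?f (a, b)) = ?f (b, b)"
    if ab: "a \<le> b" "ext b \<le> bdeg x - ext p" for a b
    using gpathsD[OF x mono[OF ab(1)] le[OF ab(2)]] f[OF ab] f[OF order_refl ab(2)]
      f[OF order_refl ext_mono[OF ab]] diff by simp
  show "?f (a, c) = cmp \<Lambda> (?f (a, b)) (?f (b, c))"
    if abc: "a \<le> b" "b \<le> c" "ext c \<le> bdeg x - ext p" for a b c
    using gpaths_cmp[OF x mono[OF abc(1)] mono[OF abc(2)] le[OF abc(3)]]
      f[OF abc(1) ext_mono[OF abc(2,3)]] f[OF abc(2,3)] f[OF order_trans[OF abc(1,2)] abc(3)] by simp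
  show "?f (a, b) = undefined" if "\<not> (a \<le> b \<and> ext b \<le> bdeg x - ext p)" for a b
    using that by (auto simp: Omega_def restrict_def)
qed

text \<open>Cancelling the removed segment x(0,p) matches the prefixes of x that extend it with the
  prefixes of the shifted path.\<close>

lemma initials_shift:
  assumes x: "x \<in> gpaths \<Lambda>" and p: "ext p \<le> bdeg x"
  shows "initials \<Lambda> (shift p x) =
    {n \<in> paths \<Lambda>. rg \<Lambda> n = sr \<Lambda> (seg x 0 p) \<and> cmp \<Lambda> (seg x 0 p) n \<in> initials \<Lambda> x}"
proof -
  let ?l = "seg x 0 p"
  have l: "?l \<in> paths \<Lambda>" "deg \<Lambda> ?l = p" "sr \<Lambda> ?l = seg x p p"
    using gpathsD[OF x zero_le_fun p] by simp_all
  have "n \<in> initials \<Lambda> (shift p x) \<longleftrightarrow> rg \<Lambda> n = sr \<Lambda> ?l \<and> cmp \<Lambda> ?l n \<in> initials \<Lambda> x"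
    if n: "n \<in> paths \<Lambda>" for n
  proof -
    have 1: "n \<in> initials \<Lambda> (shift p x) \<longleftrightarrow> ext (p + deg \<Lambda> n) \<le> bdeg x \<and> seg x p (p + deg \<Lambda> n) = n"
      using n ext_le_diff_iff[OF p] by (auto simp: initials_def shift_def Omega_def add.commute)
    show ?thesis
    proof (cases "rg \<Lambda> n = sr \<Lambda> ?l \<and> ext (p + deg \<Lambda> n) \<le> bdeg x")
      case True
      then have r: "rg \<Lambda> n = sr \<Lambda> ?l" and e: "ext (p + deg \<Lambda> n) \<le> bdeg x" by auto
      let ?s = "seg x p (p + deg \<Lambda> n)"
      have s: "?s \<in> paths \<Lambda>" "sr \<Lambda> ?l = rg \<Lambda> ?s" "cmp \<Lambda> ?l ?s = seg x 0 (p + deg \<Lambda> n)"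
        using gpathsD[OF x le_add_fun(1) e] gpaths_cmp[OF x zero_le_fun le_add_fun(1) e] l by auto
      have "cmp \<Lambda> ?l n \<in> initials \<Lambda> x \<longleftrightarrow> cmp \<Lambda> ?l ?s = cmp \<Lambda> ?l n"
        using e s l n r by (simp add: initials_def cmp_closed deg_cmp)
      also have "\<dots> \<longleftrightarrow> ?s = n" using cmp_left_cancel[OF l(1) s(1,2) n r[symmetric]] by metis
      finally show ?thesis using 1 r e by simp
    next
      \<comment> \<open>Neither side can hold, since each of them implies both conditions of the
        case split.\<close>
      case False
      have "rg \<Lambda> n = sr \<Lambda> ?l" if "ext (p + deg \<Lambda> n) \<le> bdeg x" "seg x p (p + deg \<Lambda> n) = n"
        using gpathsD(3)[OF x le_add_fun(1) that(1)] that(2) l(3) by simp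
      moreover have "ext (p + deg \<Lambda> n) \<le> bdeg x" if "rg \<Lambda> n = sr \<Lambda> ?l" "cmp \<Lambda> ?l n \<in> initials \<Lambda> x"
        using that deg_cmp[OF l(1) n] l(2) by (simp add: initials_def)
      ultimately show ?thesis using False 1 by blast
    qed
  qed
  moreover have "initials \<Lambda> (shift p x) \<subseteq> paths \<Lambda>" by (auto simp: initials_def)
  ultimately show ?thesis by blast
qed

lemma orbit_iff_tail_eq:
  assumes "x \<in> boundary_paths \<Lambda>" "y \<in> boundary_paths \<Lambda>"
  shows "y \<in> orbit \<Lambda> x \<longleftrightarrow> (\<exists>l m. tail_eq \<Lambda> l m (initials \<Lambda> x) (initials \<Lambda> y))"
proof -
  have x: "x \<in> gpaths \<Lambda>" and y: "y \<in> gpaths \<Lambda>" using assms boundary_paths_gpaths by auto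
  show ?thesis
  proof
    assume "y \<in> orbit \<Lambda> x"
    then obtain p q where p: "ext p \<le> bdeg x" and q: "ext q \<le> bdeg y" and eq: "shift p x = shift q y"
      by (auto simp: orbit_def)
    let ?l = "seg x 0 p" and ?m = "seg y 0 q"
    have l: "?l \<in> initials \<Lambda> x" and m: "?m \<in> initials \<Lambda> y" by (rule seg_in_initials[OF x p], rule seg_in_initials[OF y q])
    have lP: "?l \<in> paths \<Lambda>" using l by (auto simp: initials_def)
    have I: "{n \<in> paths \<Lambda>. rg \<Lambda> n = sr \<Lambda> ?l \<and> cmp \<Lambda> ?l n \<in> initials \<Lambda> x} =
        {n \<in> paths \<Lambda>. rg \<Lambda> n = sr \<Lambda> ?m \<and> cmp \<Lambda> ?m n \<in> initials \<Lambda> y}"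
      using initials_shift[OF x p] initials_shift[OF y q] eq by simp
    \<comment> \<open>This vertex is the degree-zero prefix of the tail. In the second description
      of the same set, its range yields the equality of the two sources.\<close>
    have "sr \<Lambda> ?l \<in> {n \<in> paths \<Lambda>. rg \<Lambda> n = sr \<Lambda> ?l \<and> cmp \<Lambda> ?l n \<in> initials \<Lambda> x}"
      using lP l by (simp add: sr_closed rg_sr cmp_sr)
    then have s: "sr \<Lambda> ?l = sr \<Lambda> ?m" unfolding I using lP by (simp add: rg_sr)
    then have "tail_eq \<Lambda> ?l ?m (initials \<Lambda> x) (initials \<Lambda> y)" unfolding tail_eq_def using l m I by auto
    then show "\<exists>l m. tail_eq \<Lambda> l m (initials \<Lambda> x) (initials \<Lambda> y)" by blast
  next
    assume "\<exists>l m. tail_eq \<Lambda> l m (initials \<Lambda> x) (initials \<Lambda> y)"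
    then obtain l m where t: "tail_eq \<Lambda> l m (initials \<Lambda> x) (initials \<Lambda> y)" by blast
    have l: "ext (deg \<Lambda> l) \<le> bdeg x" "seg x 0 (deg \<Lambda> l) = l" using tail_eqD(1)[OF t] by (auto simp: initials_def)
    have m: "ext (deg \<Lambda> m) \<le> bdeg y" "seg y 0 (deg \<Lambda> m) = m" using tail_eqD(2)[OF t] by (auto simp: initials_def)
    have "shift (deg \<Lambda> l) x = shift (deg \<Lambda> m) y"
    proof (rule initials_inj[OF shift_gpaths[OF x l(1)] shift_gpaths[OF y m(1)]])
      show "initials \<Lambda> (shift (deg \<Lambda> l) x) = initials \<Lambda> (shift (deg \<Lambda> m) y)"
        unfolding initials_shift[OF x l(1)] initials_shift[OF y m(1)] l(2) m(2)
        using tail_eqD(3,4)[OF t] by auto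
    qed
    then show "y \<in> orbit \<Lambda> x" unfolding orbit_def using assms(2) l(1) m(1) by blast
  qed
qed

lemma tail_eq_extend:
  assumes t: "tail_eq \<Lambda> l m X Y" and r: "r \<in> paths \<Lambda>" "rg \<Lambda> r = sr \<Lambda> l" "cmp \<Lambda> l r \<in> X"
    and lm: "l \<in> paths \<Lambda>" "m \<in> paths \<Lambda>"
  shows "tail_eq \<Lambda> (cmp \<Lambda> l r) (cmp \<Lambda> m r) X Y"
proof -
  note s = tail_eqD(3)[OF t]
  have "cmp \<Lambda> m r \<in> Y" using tail_eqD(4)[OF t r(1,2)] r(3) by simp
  moreover have "cmp \<Lambda> (cmp \<Lambda> l r) n \<in> X \<longleftrightarrow> cmp \<Lambda> (cmp \<Lambda> m r) n \<in> Y"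
    if n: "n \<in> paths \<Lambda>" "rg \<Lambda> n = sr \<Lambda> r" for n
    using tail_eqD(4)[OF t, of "cmp \<Lambda> r n"] n r lm s by (simp add: cmp_assoc cmp_closed rg_cmp)
  ultimately show ?thesis using r lm s by (auto simp: tail_eq_def sr_cmp)
qed

text \<open>The prefixes \<open>m\<close> and \<open>m'\<close> of the middle path need not agree.
  Both tail equalities are moved by \<open>tail_eq_extend\<close> to a minimal common extension of
  them inside \<open>Y\<close>.\<close>

lemma tail_eq_trans:
  assumes t: "tail_eq \<Lambda> l m X Y" and u: "tail_eq \<Lambda> m' k Y Z"
    and X: "X \<subseteq> paths \<Lambda>" and Y: "Y \<in> boundary_filters \<Lambda>" and Z: "Z \<subseteq> paths \<Lambda>"
  shows "\<exists>l k. tail_eq \<Lambda> l k X Z"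
proof -
  obtain r s where rs: "(r, s) \<in> min_ext \<Lambda> m m'" "cmp \<Lambda> m r \<in> Y"
    using boundary_filtersD(4)[OF Y tail_eqD(2)[OF t] tail_eqD(1)[OF u]] by blast
  then have r: "r \<in> paths \<Lambda>" "rg \<Lambda> r = sr \<Lambda> m" and s: "s \<in> paths \<Lambda>" "rg \<Lambda> s = sr \<Lambda> m'"
    and e: "cmp \<Lambda> m r = cmp \<Lambda> m' s" by (auto simp: min_ext_def)
  have P: "l \<in> paths \<Lambda>" "m \<in> paths \<Lambda>" "m' \<in> paths \<Lambda>" "k \<in> paths \<Lambda>"
    using X boundary_filtersD(1)[OF Y] Z tail_eqD(1,2)[OF t] tail_eqD(1,2)[OF u] by auto
  have "tail_eq \<Lambda> (cmp \<Lambda> m r) (cmp \<Lambda> l r) Y X"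
    by (rule tail_eq_extend[OF tail_eq_sym[OF t] r rs(2) P(2,1)])
  moreover have "tail_eq \<Lambda> (cmp \<Lambda> m r) (cmp \<Lambda> k s) Y Z"
    unfolding e by (rule tail_eq_extend[OF u s _ P(3,4)]) (use rs(2) e in simp)
  ultimately have "tail_eq \<Lambda> (cmp \<Lambda> l r) (cmp \<Lambda> k s) X Z" by (auto simp: tail_eq_def)
  then show ?thesis by blast
qed

lemma orbit_refl:
  assumes "x \<in> boundary_paths \<Lambda>"
  shows "x \<in> orbit \<Lambda> x"
  using assms by (auto simp: orbit_def intro!: exI[of _ 0])

lemma orbit_sym:
  assumes "x \<in> boundary_paths \<Lambda>" "y \<in> orbit \<Lambda> x"
  shows "x \<in> orbit \<Lambda> y"
  using assms by (auto simp: orbit_def) metis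

lemma orbit_trans:
  assumes x: "x \<in> boundary_paths \<Lambda>" and y: "y \<in> orbit \<Lambda> x" and z: "z \<in> orbit \<Lambda> y"
  shows "z \<in> orbit \<Lambda> x"
proof -
  have b: "y \<in> boundary_paths \<Lambda>" "z \<in> boundary_paths \<Lambda>" using y z by (auto simp: orbit_def)
  obtain l m m' k where "tail_eq \<Lambda> l m (initials \<Lambda> x) (initials \<Lambda> y)"
    "tail_eq \<Lambda> m' k (initials \<Lambda> y) (initials \<Lambda> z)"
    using y z orbit_iff_tail_eq[OF x b(1)] orbit_iff_tail_eq[OF b] by blast
  then show ?thesis
    using tail_eq_trans initials_boundary_filter[OF b(1)] orbit_iff_tail_eq[OF x b(2)]
    by (metis (no_types, lifting) boundary_filtersD(1) initials_boundary_filter b(2) x)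
qed

lemma orbit_eq_iff:
  assumes "x \<in> boundary_paths \<Lambda>" "y \<in> boundary_paths \<Lambda>"
  shows "orbit \<Lambda> y = orbit \<Lambda> x \<longleftrightarrow> y \<in> orbit \<Lambda> x"
  using assms orbit_refl orbit_sym orbit_trans by blast

section \<open>Exchanging a prefix\<close>

lemma tail_eq_transplant:
  assumes X: "X \<in> boundary_filters \<Lambda>" and k: "k \<in> X" and l: "l \<in> paths \<Lambda>" "sr \<Lambda> l = sr \<Lambda> k"
  shows "tail_eq \<Lambda> k l X (transplant \<Lambda> k l X)"
proof -
  have kP: "k \<in> paths \<Lambda>" using boundary_filtersD(1)[OF X] k by auto
  have "cmp \<Lambda> k n \<in> X \<longleftrightarrow> cmp \<Lambda> l n \<in> transplant \<Lambda> k l X" if n: "n \<in> paths \<Lambda>" "rg \<Lambda> n = sr \<Lambda> k" for n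
  proof
    assume "cmp \<Lambda> k n \<in> X"
    then show "cmp \<Lambda> l n \<in> transplant \<Lambda> k l X"
      using n l by (auto simp: transplant_def cmp_closed intro!: bexI[of _ n] initial_refl)
  next
    assume "cmp \<Lambda> l n \<in> transplant \<Lambda> k l X"
    then obtain n' where n': "n' \<in> paths \<Lambda>" "rg \<Lambda> n' = sr \<Lambda> k" "cmp \<Lambda> k n' \<in> X" "initial \<Lambda> (cmp \<Lambda> l n) (cmp \<Lambda> l n')"
      by (auto simp: transplant_def)
    \<comment> \<open>Cancel \<open>l\<close>, then prepend \<open>k\<close>: the prefix relation
      between tails does not depend on what precedes them.\<close>
    then have "initial \<Lambda> n n'" using initial_cmp_left_iff n l by auto
    then have "initial \<Lambda> (cmp \<Lambda> k n) (cmp \<Lambda> k n')" using initial_cmp_left_iff n n' kP by auto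
    then show "cmp \<Lambda> k n \<in> X" using boundary_filtersD(3)[OF X] n'(3) by blast
  qed
  moreover have "l \<in> transplant \<Lambda> k l X"
    unfolding transplant_def using k l kP
    by (auto intro!: bexI[of _ "sr \<Lambda> k"] simp: cmp_sr rg_sr sr_closed) (metis cmp_sr initial_refl l(2))
  ultimately show ?thesis using k l by (auto simp: tail_eq_def)
qed

text \<open>Every \<open>a\<close> in \<open>Y\<close> has a common extension with \<open>l\<close>
  in \<open>Y\<close>; it has the form le, and its tail e can be read behind \<open>k\<close> in
  \<open>X\<close>. This uniqueness serves twice: to count orbits and to show that the exchange of
  prefixes is injective.\<close>

lemma transplant_unique:
  assumes X: "X \<in> boundary_filters \<Lambda>" and Y: "Y \<in> boundary_filters \<Lambda>" and t: "tail_eq \<Lambda> k l X Y"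
  shows "Y = transplant \<Lambda> k l X"
proof (intro equalityI subsetI)
  fix a assume a: "a \<in> Y"
  note l = tail_eqD(2)[OF t] and s = tail_eqD(3)[OF t]
  have P: "a \<in> paths \<Lambda>" "l \<in> paths \<Lambda>" using boundary_filtersD(1)[OF Y] a l by auto
  obtain c e where c: "(c, e) \<in> min_ext \<Lambda> a l" "cmp \<Lambda> a c \<in> Y" using boundary_filtersD(4)[OF Y a l] by blast
  then have e: "e \<in> paths \<Lambda>" "rg \<Lambda> e = sr \<Lambda> l" "cmp \<Lambda> a c = cmp \<Lambda> l e" by (auto simp: min_ext_def)
  have "cmp \<Lambda> k e \<in> X" using tail_eqD(4)[OF t e(1)] e s c(2) by simp
  then show "a \<in> transplant \<Lambda> k l X"
    using min_ext_initial(1)[OF c(1) P] e s by (auto simp: transplant_def)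
next
  fix a assume "a \<in> transplant \<Lambda> k l X"
  then obtain n where n: "n \<in> paths \<Lambda>" "rg \<Lambda> n = sr \<Lambda> k" "cmp \<Lambda> k n \<in> X" "initial \<Lambda> a (cmp \<Lambda> l n)"
    by (auto simp: transplant_def)
  then have "cmp \<Lambda> l n \<in> Y" using tail_eqD(4)[OF t n(1,2)] by simp
  then show "a \<in> Y" using boundary_filtersD(3)[OF Y n(4)] by blast
qed

end

section \<open>Finite alignment and the boundary condition\<close>

locale finitely_aligned_graph = higher_rank_graph +
  assumes aligned: "finitely_aligned \<Lambda>"
begin

lemma finite_min_ext: "a \<in> paths \<Lambda> \<Longrightarrow> b \<in> paths \<Lambda> \<Longrightarrow> finite (min_ext \<Lambda> a b)"
  using aligned by (auto simp: finitely_aligned_def)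

text \<open>The pullback of \<open>E\<close> along \<open>\<rho>\<close>: all \<beta> such that
  \<rho>\<beta> is a minimal common extension of \<rho> and a member of \<open>E\<close>. Given
  \<gamma>, some \<open>e\<close> in \<open>E\<close> has a common extension with \<rho>\<gamma>.
  That extension lies above some \<rho>\<beta>, and cancelling \<rho> leaves a common extension of
  \<beta> and \<gamma>.\<close>

lemma exhaustive_min_ext:
  assumes E: "finite E" "exhaustive \<Lambda> (rg \<Lambda> \<rho>) E" and \<rho>: "\<rho> \<in> paths \<Lambda>"
  defines "E' \<equiv> \<Union>e\<in>E. snd ` min_ext \<Lambda> e \<rho>"
  shows "finite E'" "exhaustive \<Lambda> (sr \<Lambda> \<rho>) E'"
proof -
  have EP: "E \<subseteq> paths \<Lambda>" using E(2) by (auto simp: exhaustive_def paths_at_def)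
  show "finite E'" unfolding E'_def using E(1) EP finite_min_ext \<rho> by auto
  have "E' \<subseteq> paths_at \<Lambda> (sr \<Lambda> \<rho>)" by (auto simp: E'_def min_ext_def paths_at_def)
  moreover have "\<exists>\<beta>\<in>E'. min_ext \<Lambda> \<beta> \<gamma> \<noteq> {}" if \<gamma>: "\<gamma> \<in> paths_at \<Lambda> (sr \<Lambda> \<rho>)" for \<gamma>
  proof -
    have g: "\<gamma> \<in> paths \<Lambda>" "sr \<Lambda> \<rho> = rg \<Lambda> \<gamma>" using \<gamma> by (auto simp: paths_at_def)
    have "cmp \<Lambda> \<rho> \<gamma> \<in> paths_at \<Lambda> (rg \<Lambda> \<rho>)" using g \<rho> by (simp add: paths_at_def cmp_closed rg_cmp)
    then obtain e c d where e: "e \<in> E" and cd: "(c, d) \<in> min_ext \<Lambda> e (cmp \<Lambda> \<rho> \<gamma>)"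
      using E(2) unfolding exhaustive_def by (metis all_not_in_conv surj_pair)
    have eP: "e \<in> paths \<Lambda>" using e EP by auto
    let ?f = "cmp \<Lambda> e c"
    have d: "d \<in> paths \<Lambda>" "sr \<Lambda> \<gamma> = rg \<Lambda> d" "?f = cmp \<Lambda> \<rho> (cmp \<Lambda> \<gamma> d)"
      using cd g \<rho> by (auto simp: min_ext_def sr_cmp cmp_assoc)
    have gd: "cmp \<Lambda> \<gamma> d \<in> paths \<Lambda>" "sr \<Lambda> \<rho> = rg \<Lambda> (cmp \<Lambda> \<gamma> d)" using d g by (auto simp: cmp_closed rg_cmp)
    have "initial \<Lambda> e ?f" using min_ext_initial(1)[OF cd eP] g \<rho> by (simp add: cmp_closed)
    moreover have "initial \<Lambda> \<rho> ?f" unfolding d(3) using \<rho> gd by (rule initialI)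
    ultimately obtain c' \<beta> where \<beta>: "(c', \<beta>) \<in> min_ext \<Lambda> e \<rho>" "initial \<Lambda> (cmp \<Lambda> e c') ?f"
      by (rule min_ext_below)
    have b: "\<beta> \<in> paths \<Lambda>" "sr \<Lambda> \<rho> = rg \<Lambda> \<beta>" "cmp \<Lambda> e c' = cmp \<Lambda> \<rho> \<beta>" using \<beta>(1) by (auto simp: min_ext_def)
    have "initial \<Lambda> \<beta> (cmp \<Lambda> \<gamma> d)"
      using \<beta>(2) initial_cmp_left_iff[OF \<rho> b(1,2) gd] unfolding d(3) b(3) by simp
    moreover have "initial \<Lambda> \<gamma> (cmp \<Lambda> \<gamma> d)" using g(1) d(1,2) by (rule initialI)
    ultimately obtain u w where "(u, w) \<in> min_ext \<Lambda> \<beta> \<gamma>" by (rule min_ext_below)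
    moreover have "\<beta> \<in> E'" unfolding E'_def using e \<beta>(1) by force
    ultimately show ?thesis by blast
  qed
  ultimately show "exhaustive \<Lambda> (sr \<Lambda> \<rho>) E'" by (auto simp: exhaustive_def)
qed

text \<open>Directedness is settled among tails behind \<open>k\<close> and carried back behind
  \<open>l\<close>. The boundary condition is also required at prefixes \<open>a\<close> that do not
  reach past \<open>l\<close>; such an \<open>a\<close> is first extended into the tail.\<close>

lemma transplant_boundary_filter:
  assumes X: "X \<in> boundary_filters \<Lambda>" and k: "k \<in> X" and l: "l \<in> paths \<Lambda>" "sr \<Lambda> l = sr \<Lambda> k"
  shows "transplant \<Lambda> k l X \<in> boundary_filters \<Lambda>"
proof -
  let ?T = "transplant \<Lambda> k l X"
  have kP: "k \<in> paths \<Lambda>" using boundary_filtersD(1)[OF X] k by auto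
  have T: "a \<in> ?T \<longleftrightarrow> (\<exists>n\<in>paths \<Lambda>. rg \<Lambda> n = sr \<Lambda> k \<and> cmp \<Lambda> k n \<in> X \<and> initial \<Lambda> a (cmp \<Lambda> l n))" for a
    by (simp add: transplant_def)
  have "?T \<subseteq> paths \<Lambda>" using initial_paths by (auto simp: T)
  moreover have "?T \<noteq> {}" using tail_eqD(2)[OF tail_eq_transplant[OF assms]] by auto
  moreover have "a \<in> ?T" if "initial \<Lambda> a b" "b \<in> ?T" for a b
    using that initial_trans unfolding T by blast
  moreover have "\<exists>(c, e)\<in>min_ext \<Lambda> a b. cmp \<Lambda> a c \<in> ?T" if ab: "a \<in> ?T" "b \<in> ?T" for a b
  proof -
    obtain n where n: "n \<in> paths \<Lambda>" "rg \<Lambda> n = sr \<Lambda> k" "cmp \<Lambda> k n \<in> X" "initial \<Lambda> a (cmp \<Lambda> l n)"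
      using ab(1) T by auto
    obtain n' where n': "n' \<in> paths \<Lambda>" "rg \<Lambda> n' = sr \<Lambda> k" "cmp \<Lambda> k n' \<in> X" "initial \<Lambda> b (cmp \<Lambda> l n')"
      using ab(2) T by auto
    \<comment> \<open>A common extension inside \<open>X\<close>; once \<open>k\<close> is
      cancelled, it gives one tail above both \<open>n\<close> and \<open>n'\<close>.\<close>
    obtain c e where ce: "(c, e) \<in> min_ext \<Lambda> (cmp \<Lambda> k n) (cmp \<Lambda> k n')" "cmp \<Lambda> (cmp \<Lambda> k n) c \<in> X"
      using boundary_filtersD(4)[OF X n(3) n'(3)] by blast
    have c: "c \<in> paths \<Lambda>" "sr \<Lambda> n = rg \<Lambda> c" and e: "e \<in> paths \<Lambda>" "sr \<Lambda> n' = rg \<Lambda> e"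
      and eq: "cmp \<Lambda> k (cmp \<Lambda> n c) = cmp \<Lambda> k (cmp \<Lambda> n' e)"
      using ce(1) n n' kP by (auto simp: min_ext_def sr_cmp cmp_assoc)
    let ?n = "cmp \<Lambda> n c"
    have N: "?n \<in> paths \<Lambda>" "rg \<Lambda> ?n = sr \<Lambda> k" "cmp \<Lambda> k ?n \<in> X"
      using n(1,2) c ce(2) kP by (auto simp: cmp_closed rg_cmp cmp_assoc)
    have eq': "?n = cmp \<Lambda> n' e"
      by (rule cmp_left_cancel[OF kP N(1) N(2)[symmetric] _ _ eq]) (use n' e in \<open>auto simp: cmp_closed rg_cmp\<close>)
    have "initial \<Lambda> n ?n" using n(1) c by (rule initialI)
    then have "initial \<Lambda> (cmp \<Lambda> l n) (cmp \<Lambda> l ?n)" using initial_cmp_left_iff n N l by auto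
    then have a: "initial \<Lambda> a (cmp \<Lambda> l ?n)" using n(4) initial_trans by blast
    have "initial \<Lambda> n' ?n" unfolding eq' using n'(1) e by (rule initialI)
    then have "initial \<Lambda> (cmp \<Lambda> l n') (cmp \<Lambda> l ?n)" using initial_cmp_left_iff n' N l by auto
    then have b: "initial \<Lambda> b (cmp \<Lambda> l ?n)" using n'(4) initial_trans by blast
    from a b obtain u w where "(u, w) \<in> min_ext \<Lambda> a b" "initial \<Lambda> (cmp \<Lambda> a u) (cmp \<Lambda> l ?n)"
      by (rule min_ext_below)
    then show ?thesis using N T by blast
  qed
  moreover have "\<exists>e\<in>E. cmp \<Lambda> a e \<in> ?T" if a: "a \<in> ?T" and E: "finite E" "exhaustive \<Lambda> (sr \<Lambda> a) E" for a E
  proof -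
    obtain n where n: "n \<in> paths \<Lambda>" "rg \<Lambda> n = sr \<Lambda> k" "cmp \<Lambda> k n \<in> X" "initial \<Lambda> a (cmp \<Lambda> l n)"
      using a T by auto
    from n(4) obtain \<rho> where \<rho>: "a \<in> paths \<Lambda>" "\<rho> \<in> paths \<Lambda>" "sr \<Lambda> a = rg \<Lambda> \<rho>" "cmp \<Lambda> l n = cmp \<Lambda> a \<rho>"
      by (rule initialE)
    have s: "sr \<Lambda> \<rho> = sr \<Lambda> n" using sr_cmp[OF \<rho>(1-3)] sr_cmp[OF l(1) n(1)] n(2) l(2) \<rho>(4) by simp
    \<comment> \<open>Pull \<open>E\<close> back along \<open>\<rho>\<close> to a vertex of the
      tail, where the boundary condition of \<open>X\<close> can be used at its member kn.\<close>
    define E' where "E' = (\<Union>e\<in>E. snd ` min_ext \<Lambda> e \<rho>)"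
    have "finite E'" "exhaustive \<Lambda> (sr \<Lambda> \<rho>) E'"
      using exhaustive_min_ext[OF E(1) _ \<rho>(2)] E(2) unfolding \<rho>(3) E'_def by blast+
    moreover have "sr \<Lambda> \<rho> = sr \<Lambda> (cmp \<Lambda> k n)" using s n kP by (simp add: sr_cmp)
    ultimately obtain \<beta> where "\<beta> \<in> E'" "cmp \<Lambda> (cmp \<Lambda> k n) \<beta> \<in> X"
      using boundary_filtersD(5)[OF X n(3)] by auto
    then obtain e c where e: "e \<in> E" "(c, \<beta>) \<in> min_ext \<Lambda> e \<rho>" and X\<beta>: "cmp \<Lambda> (cmp \<Lambda> k n) \<beta> \<in> X"
      by (auto simp: E'_def)
    have eP: "e \<in> paths \<Lambda>" "rg \<Lambda> e = sr \<Lambda> a" using e(1) E(2) by (auto simp: exhaustive_def paths_at_def)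
    have b: "\<beta> \<in> paths \<Lambda>" "sr \<Lambda> \<rho> = rg \<Lambda> \<beta>" "c \<in> paths \<Lambda>" "sr \<Lambda> e = rg \<Lambda> c" "cmp \<Lambda> e c = cmp \<Lambda> \<rho> \<beta>"
      using e(2) by (auto simp: min_ext_def)
    let ?n = "cmp \<Lambda> n \<beta>"
    have N: "?n \<in> paths \<Lambda>" "rg \<Lambda> ?n = sr \<Lambda> k" "cmp \<Lambda> k ?n \<in> X"
      using n(1,2) b(1,2) s X\<beta> kP by (auto simp: cmp_closed rg_cmp cmp_assoc)
    \<comment> \<open>The \<beta> obtained satisfies \<rho>\<beta> = ec with \<open>e\<close> in
      \<open>E\<close>. Hence ln\<beta> = a\<rho>\<beta> = aec has ae as a prefix.\<close>
    have "cmp \<Lambda> l ?n = cmp \<Lambda> (cmp \<Lambda> a \<rho>) \<beta>"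
      unfolding \<rho>(4)[symmetric] using n(1,2) b(1,2) s l by (simp add: cmp_assoc)
    also have "\<dots> = cmp \<Lambda> a (cmp \<Lambda> e c)" using \<rho>(1-3) b(1,2,5) by (simp add: cmp_assoc)
    also have "\<dots> = cmp \<Lambda> (cmp \<Lambda> a e) c" using \<rho>(1) eP b(3,4) by (simp add: cmp_assoc)
    finally have "initial \<Lambda> (cmp \<Lambda> a e) (cmp \<Lambda> l ?n)"
      using \<rho>(1) eP b(3,4) by (auto simp: cmp_closed sr_cmp intro: initialI)
    then show ?thesis using N T e(1) by blast
  qed
  ultimately show ?thesis unfolding boundary_filters_def by blast
qed

lemma countable_orbit:
  assumes x: "x \<in> boundary_paths \<Lambda>" and "countable (paths \<Lambda>)"
  shows "countable (orbit \<Lambda> x)"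
proof (rule countable_subset)
  let ?f = "\<lambda>(k, l). path_of (transplant \<Lambda> k l (initials \<Lambda> x))"
  show "orbit \<Lambda> x \<subseteq> ?f ` (paths \<Lambda> \<times> paths \<Lambda>)"
  proof
    fix y assume y: "y \<in> orbit \<Lambda> x"
    then have yb: "y \<in> boundary_paths \<Lambda>" by (auto simp: orbit_def)
    obtain k l where t: "tail_eq \<Lambda> k l (initials \<Lambda> x) (initials \<Lambda> y)" using y orbit_iff_tail_eq[OF x yb] by blast
    have "initials \<Lambda> y = transplant \<Lambda> k l (initials \<Lambda> x)"
      by (rule transplant_unique[OF initials_boundary_filter[OF x] initials_boundary_filter[OF yb] t])
    then have "y = ?f (k, l)" using path_of_initials[OF yb] by simp
    moreover have "(k, l) \<in> paths \<Lambda> \<times> paths \<Lambda>" using tail_eqD(1,2)[OF t] by (auto simp: initials_def)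
    ultimately show "y \<in> ?f ` (paths \<Lambda> \<times> paths \<Lambda>)" by blast
  qed
  show "countable (?f ` (paths \<Lambda> \<times> paths \<Lambda>))" using assms(2) by (intro countable_image countable_SIGMA) auto
qed

end

section \<open>The topology of the boundary path space\<close>

text \<open>Without isolated points, the closed singletons have empty interior. By Baire so has
  their countable union, which is the whole space.\<close>

lemma ex_isolated_point_countable_compact:
  assumes "compact_space X" "Hausdorff_space X" "countable (topspace X)" "topspace X \<noteq> {}"
  shows "\<exists>x\<in>topspace X. openin X {x}"
proof (rule ccontr)
  assume no: "\<not> ?thesis"
  have "X interior_of {x} = {}" if "x \<in> topspace X" for x
  proof (rule ccontr)
    assume "X interior_of {x} \<noteq> {}"
    then have "X interior_of {x} = {x}" using interior_of_subset[of X "{x}"] by auto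
    then show False using no that openin_interior_of[of X "{x}"] by auto
  qed
  moreover have "closedin X {x}" if "x \<in> topspace X" for x
    using that Hausdorff_imp_t1_space[OF assms(2)] by (simp add: t1_space_closedin_singleton)
  ultimately have "X interior_of \<Union>((\<lambda>x. {x}) ` topspace X) = {}"
    using assms compact_Hausdorff_imp_regular_space[OF assms(1,2)] compact_imp_locally_compact_space[OF assms(1)]
    by (intro Baire_category_alt) auto
  then show False using assms(4) by simp
qed

text \<open>In a finite subcover by isolating sets, each set accounts for one point of
  \<open>K\<close> only.\<close>

lemma compactin_isolated_imp_finite:
  assumes K: "compactin X K" and iso: "\<And>x. x \<in> K \<Longrightarrow> \<exists>U. openin X U \<and> U \<inter> K = {x}"
  shows "finite K"
proof -
  obtain U where U: "\<And>x. x \<in> K \<Longrightarrow> openin X (U x)" "\<And>x. x \<in> K \<Longrightarrow> U x \<inter> K = {x}"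
    using iso by metis
  have "(\<forall>V\<in>U ` K. openin X V) \<and> K \<subseteq> \<Union> (U ` K)" using U by blast
  then obtain \<F> where \<F>: "finite \<F>" "\<F> \<subseteq> U ` K" "K \<subseteq> \<Union> \<F>"
    using K unfolding compactin_def by meson
  obtain F where F: "finite F" "F \<subseteq> K" "\<F> = U ` F"
    using finite_subset_image[OF \<F>(1,2)] by blast
  have "K \<subseteq> F"
  proof
    fix x assume x: "x \<in> K"
    then obtain y where y: "y \<in> F" "x \<in> U y" using \<F>(3) F(3) by auto
    then have "x \<in> U y \<inter> K" using x by simp
    then show "x \<in> F" using U(2)[OF subsetD[OF F(2) y(1)]] y(1) by simp
  qed
  then show ?thesis using F(1) finite_subset by blast
qed

lemma open_preimage_coordinate:
  fixes S :: "bool set"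
  shows "openin (product_topology (\<lambda>_. discrete_topology UNIV) UNIV) {u. u a \<in> S}"
  using openin_continuous_map_preimage[OF continuous_map_product_coordinates[of a UNIV "\<lambda>_. discrete_topology UNIV"], of S]
  by simp

lemma closed_preimage_coordinate:
  fixes S :: "bool set"
  shows "closedin (product_topology (\<lambda>_. discrete_topology UNIV) UNIV) {u. u a \<in> S}"
  using closedin_continuous_map_preimage[OF continuous_map_product_coordinates[of a UNIV "\<lambda>_. discrete_topology UNIV"], of S]
  by simp

text \<open>This rule and the next three read closedness off the logical form of a condition:
  universal quantifiers, implications with an open or a constant premise, finite
  disjunctions.\<close>

lemma closedin_Collect_all:
  assumes "\<And>i. closedin X {x. P i x}"
  shows "closedin X {x. \<forall>i. P i x}"
proof -
  have "{x. \<forall>i. P i x} = (\<Inter>i. {x. P i x})" by auto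
  then show ?thesis using assms by (auto intro!: closedin_Inter)
qed

lemma closedin_Collect_imp:
  assumes "topspace X = UNIV" "openin X {x. P x}" "closedin X {x. Q x}"
  shows "closedin X {x. P x \<longrightarrow> Q x}"
proof -
  have "{x. P x \<longrightarrow> Q x} = (topspace X - {x. P x}) \<union> {x. Q x}" using assms(1) by auto
  also have "closedin X \<dots>" by (intro closedin_Un closedin_diff closedin_topspace assms)
  finally show ?thesis .
qed

lemma closedin_Collect_const_imp:
  assumes "topspace X = UNIV" "P \<Longrightarrow> closedin X {x. Q x}"
  shows "closedin X {x. P \<longrightarrow> Q x}"
  using assms closedin_topspace[of X] by (cases P) auto

lemma closedin_Collect_bex:
  assumes "finite I" "\<And>i. i \<in> I \<Longrightarrow> closedin X {x. P i x}"
  shows "closedin X {x. \<exists>i\<in>I. P i x}"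
proof -
  have "{x. \<exists>i\<in>I. P i x} = (\<Union>i\<in>I. {x. P i x})" by auto
  then show ?thesis using assms by (auto intro!: closedin_Union)
qed

section \<open>Cylinders are clopen and separate points\<close>

context higher_rank_graph
begin

lemma rg_eq_boundary_filter:
  assumes X: "X \<in> boundary_filters \<Lambda>" and "a \<in> X" "b \<in> X"
  shows "rg \<Lambda> a = rg \<Lambda> b"
proof -
  have P: "a \<in> paths \<Lambda>" "b \<in> paths \<Lambda>" using boundary_filtersD(1)[OF X] assms by auto
  obtain c e where "(c, e) \<in> min_ext \<Lambda> a b" using boundary_filtersD(4)[OF assms] by blast
  then show ?thesis using min_ext_initial[OF _ P] initial_rg by metis
qed

lemma rg_in_boundary_filter:
  "X \<in> boundary_filters \<Lambda> \<Longrightarrow> a \<in> X \<Longrightarrow> rg \<Lambda> a \<in> X"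
  by (meson boundary_filtersD(1,3) initial_rg_self subsetD)

lemma openin_cylinder_diff:
  "a \<in> paths \<Lambda> \<Longrightarrow> finite F \<Longrightarrow> F \<subseteq> paths_at \<Lambda> (sr \<Lambda> a) \<Longrightarrow>
    openin (boundary_topology \<Lambda>) (cylinder_diff \<Lambda> a F)"
  unfolding boundary_topology_def by (rule topology_generated_by_Basis) blast

lemma openin_cylinder: "a \<in> paths \<Lambda> \<Longrightarrow> openin (boundary_topology \<Lambda>) (cylinder \<Lambda> a)"
  using openin_cylinder_diff[of a "{}"] by (simp add: cylinder_diff_def)

text \<open>A path outside Z(a) either starts at r(a), and then Z(r(a)) minus Z(a) is a basic
  neighbourhood of it, or starts at another vertex, whose cylinder is disjoint from Z(a).\<close>

lemma closedin_cylinder: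
  assumes a: "a \<in> paths \<Lambda>"
  shows "closedin (boundary_topology \<Lambda>) (cylinder \<Lambda> a)"
proof -
  have "\<exists>U. openin (boundary_topology \<Lambda>) U \<and> y \<in> U \<and> U \<subseteq> boundary_paths \<Lambda> - cylinder \<Lambda> a"
    if y: "y \<in> boundary_paths \<Lambda> - cylinder \<Lambda> a" for y
  proof -
    have yb: "y \<in> boundary_paths \<Lambda>" "a \<notin> initials \<Lambda> y" using y a by (auto simp: in_cylinder_iff)
    note Y = initials_boundary_filter[OF yb(1)]
    obtain b where b: "b \<in> initials \<Lambda> y" using boundary_filtersD(2)[OF Y] by blast
    have v: "rg \<Lambda> b \<in> initials \<Lambda> y" "rg \<Lambda> b \<in> paths \<Lambda>"
      using rg_in_boundary_filter[OF Y b] by (auto simp: initials_def)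
    show ?thesis
    proof (cases "rg \<Lambda> b = rg \<Lambda> a")
      case True
      have "{a} \<subseteq> paths_at \<Lambda> (sr \<Lambda> (rg \<Lambda> a))" using a by (simp add: paths_at_def sr_rg)
      then have "openin (boundary_topology \<Lambda>) (cylinder_diff \<Lambda> (rg \<Lambda> a) {a})"
        using a by (intro openin_cylinder_diff) (auto simp: rg_closed)
      moreover have "cylinder_diff \<Lambda> (rg \<Lambda> a) {a} = cylinder \<Lambda> (rg \<Lambda> a) - cylinder \<Lambda> a"
        using a by (simp add: cylinder_diff_def cmp_rg)
      moreover have "y \<in> cylinder \<Lambda> (rg \<Lambda> a) - cylinder \<Lambda> a" using y yb(1) v True by (simp add: in_cylinder_iff)
      moreover have "cylinder \<Lambda> (rg \<Lambda> a) \<subseteq> boundary_paths \<Lambda>" by (auto simp: cylinder_def)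
      ultimately show ?thesis by (intro exI[of _ "cylinder_diff \<Lambda> (rg \<Lambda> a) {a}"]) auto
    next
      case False
      have "z \<notin> cylinder \<Lambda> a" if z: "z \<in> cylinder \<Lambda> (rg \<Lambda> b)" for z
      proof
        assume "z \<in> cylinder \<Lambda> a"
        then have "z \<in> boundary_paths \<Lambda>" "a \<in> initials \<Lambda> z" "rg \<Lambda> b \<in> initials \<Lambda> z"
          using z a v by (auto simp: in_cylinder_iff)
        from rg_eq_boundary_filter[OF initials_boundary_filter[OF this(1)] this(2,3)]
        show False using False b by (simp add: initials_def rg_rg)
      qed
      moreover have "cylinder \<Lambda> (rg \<Lambda> b) \<subseteq> boundary_paths \<Lambda>" by (auto simp: cylinder_def)
      ultimately show ?thesis using openin_cylinder[OF v(2)] yb(1) v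
        by (intro exI[of _ "cylinder \<Lambda> (rg \<Lambda> b)"]) (auto simp: in_cylinder_iff)
    qed
  qed
  then have "openin (boundary_topology \<Lambda>) (boundary_paths \<Lambda> - cylinder \<Lambda> a)"
    by (subst openin_subopen) blast
  moreover have "cylinder \<Lambda> a \<subseteq> boundary_paths \<Lambda>" by (auto simp: cylinder_def)
  ultimately show ?thesis by (simp add: closedin_def)
qed

text \<open>Distinct paths differ in some prefix a, and the clopen set Z(a) separates them.\<close>

lemma Hausdorff_boundary_topology: "Hausdorff_space (boundary_topology \<Lambda>)"
proof -
  have sep: "\<exists>U V. openin (boundary_topology \<Lambda>) U \<and> openin (boundary_topology \<Lambda>) V \<and> x \<in> U \<and> y \<in> V \<and> disjnt U V"
    if xy: "x \<in> boundary_paths \<Lambda>" "y \<in> boundary_paths \<Lambda>" "a \<in> initials \<Lambda> x" "a \<notin> initials \<Lambda> y" for x y a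
  proof -
    have a: "a \<in> paths \<Lambda>" using xy by (simp add: initials_def)
    have "openin (boundary_topology \<Lambda>) (boundary_paths \<Lambda> - cylinder \<Lambda> a)"
      using closedin_cylinder[OF a] by (simp add: closedin_def)
    then show ?thesis using openin_cylinder[OF a] xy a
      by (intro exI[of _ "cylinder \<Lambda> a"] exI[of _ "boundary_paths \<Lambda> - cylinder \<Lambda> a"])
        (auto simp: in_cylinder_iff disjnt_def)
  qed
  show ?thesis unfolding Hausdorff_space_def topspace_boundary_topology
  proof (intro allI impI)
    fix x y assume xy: "x \<in> boundary_paths \<Lambda> \<and> y \<in> boundary_paths \<Lambda> \<and> x \<noteq> y"
    then have "initials \<Lambda> x \<noteq> initials \<Lambda> y" using path_of_initials by metis
    then consider a where "a \<in> initials \<Lambda> x" "a \<notin> initials \<Lambda> y" | a where "a \<in> initials \<Lambda> y" "a \<notin> initials \<Lambda> x"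
      by blast
    then show "\<exists>U V. openin (boundary_topology \<Lambda>) U \<and> openin (boundary_topology \<Lambda>) V \<and> x \<in> U \<and> y \<in> V \<and> disjnt U V"
    proof cases
      case 1 then show ?thesis using sep xy by blast
    next
      case 2 then show ?thesis using sep[of y x] xy by (metis disjnt_sym)
    qed
  qed
qed

text \<open>A generating set is a cylinder minus finitely many cylinders, so the preimages of
  cylinders are asked to be open as well as closed.\<close>

lemma continuous_map_boundary_topology:
  assumes f: "f \<in> topspace S \<rightarrow> boundary_paths \<Lambda>"
    and op: "\<And>a. a \<in> paths \<Lambda> \<Longrightarrow> openin S {x \<in> topspace S. a \<in> initials \<Lambda> (f x)}"
    and cl: "\<And>a. a \<in> paths \<Lambda> \<Longrightarrow> closedin S {x \<in> topspace S. a \<in> initials \<Lambda> (f x)}"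
  shows "continuous_map S (boundary_topology \<Lambda>) f"
  unfolding boundary_topology_def
proof (rule continuous_on_generated_topo)
  fix U assume "U \<in> {cylinder_diff \<Lambda> a F |a F. a \<in> paths \<Lambda> \<and> finite F \<and> F \<subseteq> paths_at \<Lambda> (sr \<Lambda> a)}"
  then obtain a F where U: "U = cylinder_diff \<Lambda> a F" and a: "a \<in> paths \<Lambda>" "finite F" "F \<subseteq> paths_at \<Lambda> (sr \<Lambda> a)"
    by blast
  let ?P = "\<lambda>a. {x \<in> topspace S. a \<in> initials \<Lambda> (f x)}"
  have P: "cmp \<Lambda> a b \<in> paths \<Lambda>" if "b \<in> F" for b using that a by (auto simp: paths_at_def cmp_closed)
  have "closedin S (\<Union>b\<in>F. ?P (cmp \<Lambda> a b))" using a(2) cl P by (auto intro!: closedin_Union)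
  then have "openin S (?P a - (\<Union>b\<in>F. ?P (cmp \<Lambda> a b)))" using op a(1) by (intro openin_diff) auto
  moreover have "f -` U \<inter> topspace S = ?P a - (\<Union>b\<in>F. ?P (cmp \<Lambda> a b))"
    using f a P by (auto simp: U cylinder_diff_def in_cylinder_iff Pi_iff)
  ultimately show "openin S (f -` U \<inter> topspace S)" by simp
next
  show "f ` topspace S \<subseteq> \<Union> {cylinder_diff \<Lambda> a F |a F. a \<in> paths \<Lambda> \<and> finite F \<and> F \<subseteq> paths_at \<Lambda> (sr \<Lambda> a)}"
    using f topspace_boundary_topology[of \<Lambda>] unfolding boundary_topology_def topology_generated_by_topspace by auto
qed

end

section \<open>Compactness of cylinders\<close>

context finitely_aligned_graph
begin

text \<open>Finite alignment and the finiteness of \<open>E\<close> turn the two existential filter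
  conditions into finite disjunctions over coordinates of the characteristic function
  \<open>u\<close>. Nonemptiness is an open condition; fixing the member \<open>v\<close> puts a
  closed one in its place.\<close>

lemma closedin_boundary_filters:
  "closedin (product_topology (\<lambda>_. discrete_topology UNIV) UNIV) {u. Collect u \<in> boundary_filters \<Lambda> \<and> u v}"
proof -
  let ?P = "product_topology (\<lambda>_. discrete_topology (UNIV :: bool set)) (UNIV :: 'a set)"
  have top: "topspace ?P = UNIV" by simp
  have cl: "closedin ?P {u. u a}" "closedin ?P {u. \<not> u a}" and op: "openin ?P {u. u a}" for a
    using closed_preimage_coordinate[of a "{True}"] closed_preimage_coordinate[of a "{False}"]
      open_preimage_coordinate[of a "{True}"] by simp_all
  note intros = closedin_Collect_all closedin_Collect_imp[OF top] closedin_Collect_const_imp[OF top]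
    closedin_Collect_bex cl op
  have "closedin ?P {u. \<forall>a. a \<notin> paths \<Lambda> \<longrightarrow> \<not> u a}" by (intro intros)
  moreover have "closedin ?P {u. \<forall>a b. initial \<Lambda> a b \<longrightarrow> u b \<longrightarrow> u a}" by (intro intros)
  moreover have "closedin ?P {u. \<forall>a b. a \<in> paths \<Lambda> \<and> b \<in> paths \<Lambda> \<longrightarrow> u a \<longrightarrow> u b \<longrightarrow>
      (\<exists>p\<in>min_ext \<Lambda> a b. u (cmp \<Lambda> a (fst p)))}"
    by (intro intros) (auto intro: finite_min_ext)
  moreover have "closedin ?P {u. \<forall>a E. finite E \<and> exhaustive \<Lambda> (sr \<Lambda> a) E \<longrightarrow> u a \<longrightarrow> (\<exists>e\<in>E. u (cmp \<Lambda> a e))}"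
    by (intro intros) auto
  ultimately have "closedin ?P (({u. \<forall>a. a \<notin> paths \<Lambda> \<longrightarrow> \<not> u a} \<inter>
      {u. \<forall>a b. initial \<Lambda> a b \<longrightarrow> u b \<longrightarrow> u a}) \<inter>
      ({u. \<forall>a b. a \<in> paths \<Lambda> \<and> b \<in> paths \<Lambda> \<longrightarrow> u a \<longrightarrow> u b \<longrightarrow> (\<exists>p\<in>min_ext \<Lambda> a b. u (cmp \<Lambda> a (fst p)))} \<inter>
      {u. \<forall>a E. finite E \<and> exhaustive \<Lambda> (sr \<Lambda> a) E \<longrightarrow> u a \<longrightarrow> (\<exists>e\<in>E. u (cmp \<Lambda> a e))}) \<inter> {u. u v})"
    by (intro closedin_Int cl(1))
  also have "(({u. \<forall>a. a \<notin> paths \<Lambda> \<longrightarrow> \<not> u a} \<inter>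
      {u. \<forall>a b. initial \<Lambda> a b \<longrightarrow> u b \<longrightarrow> u a}) \<inter>
      ({u. \<forall>a b. a \<in> paths \<Lambda> \<and> b \<in> paths \<Lambda> \<longrightarrow> u a \<longrightarrow> u b \<longrightarrow> (\<exists>p\<in>min_ext \<Lambda> a b. u (cmp \<Lambda> a (fst p)))} \<inter>
      {u. \<forall>a E. finite E \<and> exhaustive \<Lambda> (sr \<Lambda> a) E \<longrightarrow> u a \<longrightarrow> (\<exists>e\<in>E. u (cmp \<Lambda> a e))}) \<inter> {u. u v}) =
    {u. Collect u \<in> boundary_filters \<Lambda> \<and> u v}" (is "?L = ?R")
  proof (rule set_eqI)
    fix u :: "'a \<Rightarrow> bool"
    show "u \<in> ?L \<longleftrightarrow> u \<in> ?R"
      unfolding boundary_filters_def by (auto simp: split_beta) blast+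
  qed
  finally show ?thesis .
qed

text \<open>The cylinder is the image under \<open>path_of\<close> of a closed set in a compact
  product. Continuity is immediate, as membership of a prefix is a coordinate.\<close>

lemma compactin_cylinder:
  assumes a: "a \<in> paths \<Lambda>"
  shows "compactin (boundary_topology \<Lambda>) (cylinder \<Lambda> a)"
proof -
  let ?P = "product_topology (\<lambda>_. discrete_topology (UNIV :: bool set)) (UNIV :: 'a set)"
  let ?C = "{u. Collect u \<in> boundary_filters \<Lambda> \<and> u a}"
  let ?f = "\<lambda>u. path_of (Collect u)"
  have "compact_space ?P" by (simp add: compact_space_product_topology compact_space_discrete_topology)
  then have comp: "compact_space (subtopology ?P ?C)"
    using closedin_boundary_filters closedin_compact_space compact_space_subtopology by blast
  have "continuous_map (subtopology ?P ?C) (boundary_topology \<Lambda>) ?f"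
  proof (rule continuous_map_boundary_topology)
    show "?f \<in> topspace (subtopology ?P ?C) \<rightarrow> boundary_paths \<Lambda>" using path_of(1) by auto
    fix b assume "b \<in> paths \<Lambda>"
    have eq: "{u \<in> topspace (subtopology ?P ?C). b \<in> initials \<Lambda> (?f u)} = {u. u b} \<inter> ?C"
      using path_of(2) by auto
    show "openin (subtopology ?P ?C) {u \<in> topspace (subtopology ?P ?C). b \<in> initials \<Lambda> (?f u)}"
      unfolding eq openin_subtopology using open_preimage_coordinate[of b "{True}"] by auto
    show "closedin (subtopology ?P ?C) {u \<in> topspace (subtopology ?P ?C). b \<in> initials \<Lambda> (?f u)}"
      unfolding eq closedin_subtopology using closed_preimage_coordinate[of b "{True}"] by auto
  qed
  then have "compactin (boundary_topology \<Lambda>) (?f ` topspace (subtopology ?P ?C))"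
    using comp image_compactin unfolding compact_space_def by blast
  moreover have "?f ` topspace (subtopology ?P ?C) = cylinder \<Lambda> a"
  proof (intro equalityI subsetI)
    fix y assume "y \<in> ?f ` topspace (subtopology ?P ?C)"
    then show "y \<in> cylinder \<Lambda> a" using path_of a by (auto simp: in_cylinder_iff)
  next
    fix y assume "y \<in> cylinder \<Lambda> a"
    then have y: "y \<in> boundary_paths \<Lambda>" "a \<in> initials \<Lambda> y" using a by (auto simp: in_cylinder_iff)
    then have "(\<lambda>b. b \<in> initials \<Lambda> y) \<in> topspace (subtopology ?P ?C)" using initials_boundary_filter by simp
    moreover have "y = ?f (\<lambda>b. b \<in> initials \<Lambda> y)" using path_of_initials[OF y(1)] by simp
    ultimately show "y \<in> ?f ` topspace (subtopology ?P ?C)" by blast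
  qed
  ultimately show ?thesis by simp
qed

section \<open>Isolation spreads over an orbit\<close>

lemma isolated_in_orbit:
  assumes y: "y \<in> boundary_paths \<Lambda>" and z: "z \<in> orbit \<Lambda> y"
    and U: "openin (boundary_topology \<Lambda>) U" "U \<inter> orbit \<Lambda> y = {y}"
  shows "\<exists>V. openin (boundary_topology \<Lambda>) V \<and> V \<inter> orbit \<Lambda> y = {z}"
proof -
  have zb: "z \<in> boundary_paths \<Lambda>" using z by (simp add: orbit_def)
  obtain k l where t: "tail_eq \<Lambda> k l (initials \<Lambda> z) (initials \<Lambda> y)"
    using z orbit_iff_tail_eq[OF y zb] by (metis tail_eq_sym)
  have kl: "k \<in> paths \<Lambda>" "l \<in> paths \<Lambda>" "sr \<Lambda> l = sr \<Lambda> k"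
    using tail_eqD(1-3)[OF t] by (auto simp: initials_def)
  \<comment> \<open>With z = kt and y = lt, this is the exchange of \<open>k\<close> for
    \<open>l\<close> on Z(k). It takes \<open>z\<close> to \<open>y\<close>, so it pulls the set
    isolating \<open>y\<close> back to one isolating \<open>z\<close>.\<close>
  define \<phi> where "\<phi> w = path_of (transplant \<Lambda> k l (initials \<Lambda> w))" for w
  have wD: "w \<in> boundary_paths \<Lambda>" "k \<in> initials \<Lambda> w" if "w \<in> cylinder \<Lambda> k" for w
    using that kl(1) by (auto simp: in_cylinder_iff)
  have \<phi>: "\<phi> w \<in> boundary_paths \<Lambda>" "initials \<Lambda> (\<phi> w) = transplant \<Lambda> k l (initials \<Lambda> w)"
    "tail_eq \<Lambda> k l (initials \<Lambda> w) (initials \<Lambda> (\<phi> w))" if w: "w \<in> cylinder \<Lambda> k" for w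
  proof -
    note W = initials_boundary_filter[OF wD(1)[OF w]] wD(2)[OF w] kl(2,3)
    show "\<phi> w \<in> boundary_paths \<Lambda>" "initials \<Lambda> (\<phi> w) = transplant \<Lambda> k l (initials \<Lambda> w)"
      unfolding \<phi>_def using path_of[OF transplant_boundary_filter[OF W]] by auto
    then show "tail_eq \<Lambda> k l (initials \<Lambda> w) (initials \<Lambda> (\<phi> w))" using tail_eq_transplant[OF W] by simp
  qed
  have zk: "z \<in> cylinder \<Lambda> k" using zb tail_eqD(1)[OF t] kl(1) by (simp add: in_cylinder_iff)
  have \<phi>z: "\<phi> z = y"
    unfolding \<phi>_def
    using transplant_unique[OF initials_boundary_filter[OF zb] initials_boundary_filter[OF y] t] path_of_initials[OF y]
    by simp
  let ?S = "subtopology (boundary_topology \<Lambda>) (cylinder \<Lambda> k)"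
  have top: "topspace ?S = cylinder \<Lambda> k" by (auto simp: cylinder_def)
  have "continuous_map ?S (boundary_topology \<Lambda>) \<phi>"
  proof (rule continuous_map_boundary_topology)
    show "\<phi> \<in> topspace ?S \<rightarrow> boundary_paths \<Lambda>" using \<phi>(1) top by auto
    fix a assume a: "a \<in> paths \<Lambda>"
    have nP: "cmp \<Lambda> k n \<in> paths \<Lambda>" "n \<in> paths \<Lambda>" "rg \<Lambda> n = sr \<Lambda> k" "cmp \<Lambda> a c = cmp \<Lambda> l n"
      if "(c, n) \<in> min_ext \<Lambda> a l" for c n
      using that kl by (auto simp: min_ext_def cmp_closed)
    \<comment> \<open>The path \<open>a\<close> need not extend \<open>l\<close>, so its membership
      is tested on minimal common extensions ac = ln. As there are finitely many, the preimage of
      Z(a) is a finite union of cylinders Z(kn) within Z(k), hence clopen there.\<close>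
    have "a \<in> initials \<Lambda> (\<phi> w) \<longleftrightarrow> (\<exists>(c, n)\<in>min_ext \<Lambda> a l. cmp \<Lambda> k n \<in> initials \<Lambda> w)"
      if w: "w \<in> cylinder \<Lambda> k" for w
    proof
      note F = initials_boundary_filter[OF \<phi>(1)[OF w]]
      {
        assume "a \<in> initials \<Lambda> (\<phi> w)"
        then obtain c n where c: "(c, n) \<in> min_ext \<Lambda> a l" "cmp \<Lambda> a c \<in> initials \<Lambda> (\<phi> w)"
          using boundary_filtersD(4)[OF F _ tail_eqD(2)[OF \<phi>(3)[OF w]]] by blast
        then have "cmp \<Lambda> k n \<in> initials \<Lambda> w" using tail_eqD(4)[OF \<phi>(3)[OF w] nP(2,3)[OF c(1)]] nP(4)[OF c(1)] by simp
        then show "\<exists>(c, n)\<in>min_ext \<Lambda> a l. cmp \<Lambda> k n \<in> initials \<Lambda> w" using c(1) by blast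
      next
        assume "\<exists>(c, n)\<in>min_ext \<Lambda> a l. cmp \<Lambda> k n \<in> initials \<Lambda> w"
        then obtain c n where c: "(c, n) \<in> min_ext \<Lambda> a l" "cmp \<Lambda> k n \<in> initials \<Lambda> w" by blast
        then have "cmp \<Lambda> a c \<in> initials \<Lambda> (\<phi> w)"
          using tail_eqD(4)[OF \<phi>(3)[OF w] nP(2,3)[OF c(1)]] nP(4)[OF c(1)] by simp
        then show "a \<in> initials \<Lambda> (\<phi> w)"
          using boundary_filtersD(3)[OF F min_ext_initial(1)[OF c(1) a kl(2)]] by simp
      }
    qed
    then have eq: "{w \<in> topspace ?S. a \<in> initials \<Lambda> (\<phi> w)} =
        (\<Union>p\<in>min_ext \<Lambda> a l. cylinder \<Lambda> (cmp \<Lambda> k (snd p))) \<inter> cylinder \<Lambda> k"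
      unfolding top using nP(1) by (force simp: in_cylinder_iff wD)
    show "openin ?S {w \<in> topspace ?S. a \<in> initials \<Lambda> (\<phi> w)}"
      unfolding eq using nP(1) openin_cylinder by (intro openin_subtopology_Int openin_Union) auto
    show "closedin ?S {w \<in> topspace ?S. a \<in> initials \<Lambda> (\<phi> w)}"
      unfolding eq closedin_subtopology using nP(1) closedin_cylinder finite_min_ext[OF a kl(2)]
      by (intro exI[of _ "\<Union>p\<in>min_ext \<Lambda> a l. cylinder \<Lambda> (cmp \<Lambda> k (snd p))"] conjI refl closedin_Union) auto
  qed
  then have "openin ?S {w \<in> cylinder \<Lambda> k. \<phi> w \<in> U}"
    using openin_continuous_map_preimage[OF _ U(1)] top by fastforce
  then have op: "openin (boundary_topology \<Lambda>) {w \<in> cylinder \<Lambda> k. \<phi> w \<in> U}"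
    using openin_trans_full openin_cylinder[OF kl(1)] by blast
  have yU: "y \<in> U" using U(2) by auto
  have "{w \<in> cylinder \<Lambda> k. \<phi> w \<in> U} \<inter> orbit \<Lambda> y = {z}"
  proof (intro equalityI subsetI)
    fix w assume "w \<in> {w \<in> cylinder \<Lambda> k. \<phi> w \<in> U} \<inter> orbit \<Lambda> y"
    then have w: "w \<in> cylinder \<Lambda> k" "\<phi> w \<in> U" "w \<in> orbit \<Lambda> y" by auto
    have "\<phi> w \<in> orbit \<Lambda> w" using orbit_iff_tail_eq[OF wD(1)[OF w(1)] \<phi>(1)[OF w(1)]] \<phi>(3)[OF w(1)] by blast
    then have "\<phi> w \<in> orbit \<Lambda> y" using orbit_trans[OF y w(3)] by blast
    then have \<phi>w: "\<phi> w = y" using U(2) w(2) by blast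
    note I = initials_boundary_filter
    \<comment> \<open>Exchanging back, \<open>l\<close> for \<open>k\<close>, recovers both
      \<open>w\<close> and \<open>z\<close> from \<open>y\<close>; this is the injectivity of
      \<open>\<phi>\<close>.\<close>
    have "initials \<Lambda> w = transplant \<Lambda> l k (initials \<Lambda> y)"
      using transplant_unique[OF I[OF y] I[OF wD(1)[OF w(1)]] tail_eq_sym] \<phi>(3)[OF w(1)] \<phi>w by simp
    moreover have "initials \<Lambda> z = transplant \<Lambda> l k (initials \<Lambda> y)"
      using transplant_unique[OF I[OF y] I[OF zb] tail_eq_sym[OF t]] .
    ultimately have "w = z" using path_of_initials[OF wD(1)[OF w(1)]] path_of_initials[OF zb] by simp
    then show "w \<in> {z}" by simp
  qed (use zk \<phi>z yU z in auto)
  then show ?thesis using op by blast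
qed

text \<open>Under the quotient map the preimage of the point \<open>orbit \<Lambda> x\<close> is the
  orbit itself, by \<open>orbit_eq_iff\<close>, and a set is closed in the quotient exactly when its
  preimage is closed.\<close>

lemma t1_orbit_space_iff:
  "t1_space (orbit_space \<Lambda>) \<longleftrightarrow> (\<forall>x\<in>boundary_paths \<Lambda>. closedin (boundary_topology \<Lambda>) (orbit \<Lambda> x))"
proof -
  have top: "topspace (orbit_space \<Lambda>) = orbit \<Lambda> ` boundary_paths \<Lambda>"
    using quotient_imp_surjective_map[OF quotient_map_orbit[of \<Lambda>]] by simp
  have "closedin (orbit_space \<Lambda>) {orbit \<Lambda> x} \<longleftrightarrow> closedin (boundary_topology \<Lambda>) (orbit \<Lambda> x)"
    if x: "x \<in> boundary_paths \<Lambda>" for x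
  proof -
    have sub: "orbit \<Lambda> x \<subseteq> boundary_paths \<Lambda>" by (auto simp: orbit_def)
    have "{y \<in> topspace (boundary_topology \<Lambda>). orbit \<Lambda> y \<in> {orbit \<Lambda> x}} =
        {y \<in> boundary_paths \<Lambda>. y \<in> orbit \<Lambda> x}"
      by (simp add: orbit_eq_iff[OF x] cong: conj_cong)
    also have "\<dots> = orbit \<Lambda> x" using sub by blast
    finally have "{y \<in> topspace (boundary_topology \<Lambda>). orbit \<Lambda> y \<in> {orbit \<Lambda> x}} = orbit \<Lambda> x" .
    moreover have "{orbit \<Lambda> x} \<subseteq> topspace (orbit_space \<Lambda>)" using x top by simp
    ultimately show ?thesis using quotient_map_closedin[THEN iffD1, OF quotient_map_orbit[of \<Lambda>]] by auto
  qed
  then show ?thesis unfolding t1_space_closedin_singleton top by simp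
qed

end

theorem proposition8p1:
  fixes \<Lambda> :: "('a, 'k::finite) kgraph"
  assumes "higher_rank_graph \<Lambda>"
    and "countable (paths \<Lambda>)"
    and "finitely_aligned \<Lambda>"
  shows "t1_space (orbit_space \<Lambda>) \<longleftrightarrow>
    (\<forall>x\<in>boundary_paths \<Lambda>. \<forall>v\<in>vertices \<Lambda>. finite (cylinder \<Lambda> v \<inter> orbit \<Lambda> x))"
proof -
  interpret finitely_aligned_graph \<Lambda>
    using assms(1,3) by (intro finitely_aligned_graph.intro finitely_aligned_graph_axioms.intro)
  let ?T = "boundary_topology \<Lambda>"
  show ?thesis
    unfolding t1_orbit_space_iff
  proof (intro iffI ballI)
    fix x v
    assume "\<forall>x\<in>boundary_paths \<Lambda>. closedin ?T (orbit \<Lambda> x)" and x: "x \<in> boundary_paths \<Lambda>" and v: "v \<in> vertices \<Lambda>"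
    then have cl: "closedin ?T (orbit \<Lambda> x)" by blast
    have vP: "v \<in> paths \<Lambda>" using v by (simp add: vertices_def)
    let ?K = "cylinder \<Lambda> v \<inter> orbit \<Lambda> x"
    have K: "compactin ?T ?K" by (rule compact_Int_closedin[OF compactin_cylinder[OF vP] cl])
    show "finite ?K"
    proof (cases "?K = {}")
      case False
      have top: "topspace (subtopology ?T ?K) = ?K" by (auto simp: cylinder_def)
      have "\<exists>y\<in>?K. openin (subtopology ?T ?K) {y}"
        using ex_isolated_point_countable_compact[OF compact_space_subtopology[OF K]
            Hausdorff_space_subtopology[OF Hausdorff_boundary_topology], unfolded top]
          countable_orbit[OF x assms(2)] False by auto
      then obtain y U where y: "y \<in> ?K" and U: "openin ?T U" "U \<inter> ?K = {y}"
        unfolding openin_subtopology by blast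
      have yb: "y \<in> boundary_paths \<Lambda>" using y by (simp add: orbit_def)
      have eq: "orbit \<Lambda> y = orbit \<Lambda> x" using orbit_eq_iff[OF x yb] y by blast
      \<comment> \<open>A set isolating \<open>y\<close> within Z(v) is intersected with the open
        set Z(v), so that it isolates \<open>y\<close> in its whole orbit, as
        \<open>isolated_in_orbit\<close> requires.\<close>
      have U': "openin ?T (U \<inter> cylinder \<Lambda> v)" "U \<inter> cylinder \<Lambda> v \<inter> orbit \<Lambda> y = {y}"
        using U openin_cylinder[OF vP] eq by (auto simp: Int_assoc)
      show ?thesis
      proof (rule compactin_isolated_imp_finite[OF K])
        fix z assume z: "z \<in> ?K"
        then obtain V where "openin ?T V" "V \<inter> orbit \<Lambda> y = {z}"
          using isolated_in_orbit[OF yb _ U'] eq by blast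
        then show "\<exists>V. openin ?T V \<and> V \<inter> ?K = {z}" using z eq by blast
      qed
    qed simp
  next
    fix x
    assume fin: "\<forall>x\<in>boundary_paths \<Lambda>. \<forall>v\<in>vertices \<Lambda>. finite (cylinder \<Lambda> v \<inter> orbit \<Lambda> x)"
      and x: "x \<in> boundary_paths \<Lambda>"
    have "\<exists>U. openin ?T U \<and> y \<in> U \<and> U \<subseteq> boundary_paths \<Lambda> - orbit \<Lambda> x"
      if y: "y \<in> boundary_paths \<Lambda> - orbit \<Lambda> x" for y
    proof -
      note Y = initials_boundary_filter[of y]
      obtain b where "b \<in> initials \<Lambda> y" using boundary_filtersD(2)[OF Y] y by blast
      then have v: "rg \<Lambda> b \<in> initials \<Lambda> y" "rg \<Lambda> b \<in> vertices \<Lambda>" "rg \<Lambda> b \<in> paths \<Lambda>"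
        using rg_in_boundary_filter[OF Y] y by (auto simp: initials_def vertices_def deg_rg)
      \<comment> \<open>The vertex at which \<open>y\<close> starts. Its cylinder meets the orbit in
        a finite, hence closed, set, and removing that set leaves a neighbourhood of
        \<open>y\<close>.\<close>
      let ?v = "rg \<Lambda> b"
      have "cylinder \<Lambda> ?v \<inter> orbit \<Lambda> x \<subseteq> topspace ?T" by (auto simp: orbit_def)
      then have "closedin ?T (cylinder \<Lambda> ?v \<inter> orbit \<Lambda> x)"
        using fin x v(2) Hausdorff_imp_t1_space[OF Hausdorff_boundary_topology]
        by (simp add: t1_space_closedin_finite)
      then have "openin ?T (cylinder \<Lambda> ?v - cylinder \<Lambda> ?v \<inter> orbit \<Lambda> x)"
        using openin_cylinder[OF v(3)] by (rule openin_diff[rotated])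
      then show ?thesis using y v
        by (intro exI[of _ "cylinder \<Lambda> ?v - cylinder \<Lambda> ?v \<inter> orbit \<Lambda> x"])
          (auto simp: in_cylinder_iff)
    qed
    then have "openin ?T (boundary_paths \<Lambda> - orbit \<Lambda> x)" by (subst openin_subopen) blast
    moreover have "orbit \<Lambda> x \<subseteq> boundary_paths \<Lambda>" by (auto simp: orbit_def)
    ultimately show "closedin ?T (orbit \<Lambda> x)" by (simp add: closedin_def)
  qed
qed

end
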